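(* Let $k\geq 3$. For $n\geq 0$ let $f_k(n)$ be the number of $321$-$k$-gon-avoiding permutations in $S_n$ (with $f_k(0)=1$), and for $s\geq 1$ set $$L_n^k(s)=\sum_{j=0}^{s}(-1)^j\binom{s-j}{j}f_k(n-j).$$ Then for all $n\geq 2k$, $$L_n^k(2k-2)=L_{n-1}^k(2k-2)+L_{n-3}^k(2k-5)+L_{n-3}^k(2k-4)+L_{n-4}^k(2k-5)+L_{n-4}^k(2k-4).$$
   Context: A permutation $\alpha\in S_n$ contains a pattern $\tau\in S_m$ if there are indices $i_1<\dots<i_m$ such that $(\alpha_{i_1},\dots,\alpha_{i_m})$ is order-isomorphic to $\tau$; otherwise $\alpha$ avoids $\tau$. For $k\geq 2$, a permutation is $k$-gon-avoiding if it avoids each of the four patterns (written in one-line notation, entries separated by commas) $(k,k+2,k+3,\dots,2k-1,1,2k,2,3,\dots,k+1)$, $(k,k+2,k+3,\dots,2k-1,2k,1,2,3,\dots,k+1)$, $(k+1,k+2,k+3,\dots,2k-1,1,2k,2,3,\dots,k)$, $(k+1,k+2,k+3,\dots,2k-1,2k,1,2,3,\dots,k)$. A permutation is $321$-$k$-gon-avoiding if it is $k$-gon-avoiding and avoids $321$.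
   Formalization: In the first two k-gon patterns the final run "2,3,…,k+1" is read as 2,3,…,k−1,k+1 (skipping k, which is already the first entry), since otherwise the word repeats k and is not a permutation. *)

theory Defs
  imports "HOL-Combinatorics.Combinatorics"
begin

(* Permutations in S_n are represented by their one-line notation, that is, as the elements of
   permutations_of_set {1..n} (the lists enumerating 1, ..., n without repetition); patterns
   likewise.  List positions are counted from 0. *)

definition contains_pattern :: "nat list \<Rightarrow> nat list \<Rightarrow> bool" where
  "contains_pattern \<alpha> \<tau> \<longleftrightarrow>
     (\<exists>i :: nat \<Rightarrow> nat. strict_mono_on {..<length \<tau>} i \<and> i ` {..<length \<tau>} \<subseteq> {..<length \<alpha>} \<and>
        (\<forall>a<length \<tau>. \<forall>b<length \<tau>. \<alpha> ! i a < \<alpha> ! i b \<longleftrightarrow> \<tau> ! a < \<tau> ! b))"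

definition avoids :: "nat list \<Rightarrow> nat list \<Rightarrow> bool" where
  "avoids \<alpha> \<tau> \<longleftrightarrow> \<not> contains_pattern \<alpha> \<tau>"

(* In the first two patterns the value k is the first entry, so the final run "2, 3, ..., k+1"
   skips it: it reads 2, 3, ..., k-1, k+1.  For k = 4 these are the hexagon patterns
   46718235, 46781235, 56718234, 56781234. *)
definition k_gon_patterns :: "nat \<Rightarrow> nat list set" where
  "k_gon_patterns k =
     {[k] @ [k+2..<2*k] @ [1, 2*k] @ [2..<k] @ [k+1],
      [k] @ [k+2..<2*k] @ [2*k, 1] @ [2..<k] @ [k+1],
      [k+1..<2*k] @ [1, 2*k] @ [2..<k+1],
      [k+1..<2*k] @ [2*k, 1] @ [2..<k+1]}"

lemma k_gon_patterns_permutations: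
  assumes "k \<ge> 2"
  shows "k_gon_patterns k \<subseteq> permutations_of_set {1..2*k}"
  using assms by (auto simp: k_gon_patterns_def permutations_of_set_def)

lemma k_gon_patterns_4:
  "k_gon_patterns 4 =
     {[4,6,7,1,8,2,3,5], [4,6,7,8,1,2,3,5], [5,6,7,1,8,2,3,4], [5,6,7,8,1,2,3,4]}"
  by (simp add: k_gon_patterns_def upt_rec)

definition k_gon_avoiding :: "nat \<Rightarrow> nat list \<Rightarrow> bool" where
  "k_gon_avoiding k \<alpha> \<longleftrightarrow> (\<forall>\<tau>\<in>k_gon_patterns k. avoids \<alpha> \<tau>)"

definition f :: "nat \<Rightarrow> nat \<Rightarrow> nat" where
  "f k n = card {\<alpha> \<in> permutations_of_set {1..n}. avoids \<alpha> [3,2,1] \<and> k_gon_avoiding k \<alpha>}"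

lemma f_0: "k \<ge> 2 \<Longrightarrow> f k 0 = 1"
proof -
  assume "k \<ge> 2"
  then have "{\<alpha> \<in> permutations_of_set {1..0}. avoids \<alpha> [3,2,1] \<and> k_gon_avoiding k \<alpha>} = {[]}"
    by (auto simp: avoids_def k_gon_avoiding_def contains_pattern_def k_gon_patterns_def)
  then show ?thesis by (simp add: f_def)
qed

(* L k n s is L_n^k(s).  It is meant for n >= s, where the natural-number subtraction n - j
   does not truncate. *)
definition L :: "nat \<Rightarrow> nat \<Rightarrow> nat \<Rightarrow> int" where
  "L k n s = (\<Sum>j=0..s. (-1) ^ j * int ((s - j) choose j) * int (f k (n - j)))"

end

theory Submission
  imports Defs "HOL-Library.Infinite_Set" "HOL-Computational_Algebra.Formal_Power_Series"
begin

text \<open>Call an entry of a 321-avoiding permutation \<open>p\<close> large if \<open>i \<le> p i\<close> and small otherwise. Large entries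
  increase, and so do small ones, hence \<open>p\<close> is determined by the positions and the values of its large
  entries. Reading these two sets from left to right gives a path: at time \<open>t\<close> its height is the number
  of large entries with position below \<open>t\<close> and value at least \<open>t\<close> (the open ones), which is also the
  number of small entries with value below \<open>t\<close> and position at least \<open>t\<close>. Each step goes up, goes down,
  or is level of one of two kinds. The permutation contains one of the four \<open>k\<close>-gon patterns iff the path
  exceeds height \<open>k - 1\<close> or has, starting at height \<open>k - 1\<close>, two consecutive steps that are down and up,
  or level of different kinds. Decomposing paths by their first step yields a tridiagonal linear system for
  the generating functions of the paths starting at a given height. Below the top height it is solved by
  the polynomials with coefficients \<open>(-1)^j ((s - j) choose j)\<close>; the equation at height \<open>k - 1\<close> then
  expresses a combination of these polynomials times the generating function of \<open>f k\<close> as a polynomial of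
  degree less than \<open>2 * k\<close>, which is the recurrence.\<close>

section \<open>Polygons\<close>

text \<open>Below, permutations are functions permuting \<open>{..<n}\<close>, so that positions,
  values and times all count from 0; \<open>Suc\<close> restores the values in
  \<open>{1..n}\<close>.\<close>

definition one_line :: "nat \<Rightarrow> (nat \<Rightarrow> nat) \<Rightarrow> nat list" where
  "one_line n p = map (\<lambda>i. Suc (p i)) [0..<n]"

lemma length_one_line [simp]: "length (one_line n p) = n"
  by (simp add: one_line_def)

lemma nth_one_line [simp]: "i < n \<Longrightarrow> one_line n p ! i = Suc (p i)"
  by (simp add: one_line_def)

lemma contains_321_iff:
  "contains_pattern (one_line n p) [3,2,1] \<longleftrightarrow>
     (\<exists>a b c. a < b \<and> b < c \<and> c < n \<and> p c < p b \<and> p b < p a)"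
proof
  assume "contains_pattern (one_line n p) [3,2,1]"
  then obtain i where i: "strict_mono_on {..<3} i" "i ` {..<3} \<subseteq> {..<n}"
    and iso: "\<forall>a<3. \<forall>b<3. one_line n p ! i a < one_line n p ! i b \<longleftrightarrow> [3,2,1::nat] ! a < [3,2,1] ! b"
    unfolding contains_pattern_def by (auto simp: numeral_3_eq_3)
  have "i 0 < i 1" "i 1 < i 2" using i(1) by (auto simp: strict_mono_on_def)
  moreover have "i 0 < n" "i 1 < n" "i 2 < n"
    using subsetD[OF i(2), of "i 0"] subsetD[OF i(2), of "i 1"] subsetD[OF i(2), of "i 2"] by simp_all
  moreover have "p (i 1) < p (i 0)"
    using iso[rule_format, of 1 0] \<open>i 0 < n\<close> \<open>i 1 < n\<close> by simp
  moreover have "p (i 2) < p (i 1)"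
    using iso[rule_format, of 2 1] \<open>i 2 < n\<close> \<open>i 1 < n\<close> by simp
  ultimately show "\<exists>a b c. a < b \<and> b < c \<and> c < n \<and> p c < p b \<and> p b < p a" by blast
next
  assume "\<exists>a b c. a < b \<and> b < c \<and> c < n \<and> p c < p b \<and> p b < p a"
  then obtain a b c where *: "a < b" "b < c" "c < n" "p c < p b" "p b < p a" by blast
  define i where "i = (\<lambda>j::nat. if j = 0 then a else if j = 1 then b else c)"
  have lt3: "j < 3 \<longleftrightarrow> j = 0 \<or> j = 1 \<or> j = 2" for j :: nat by auto
  have "strict_mono_on {..<3} i" using * by (auto simp: strict_mono_on_def i_def lt3)
  moreover have "i ` {..<3} \<subseteq> {..<n}" using * by (auto simp: i_def)
  moreover have "\<forall>a<3. \<forall>b<3. one_line n p ! i a < one_line n p ! i b \<longleftrightarrow> [3,2,1::nat] ! a < [3,2,1] ! b"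
    using * by (auto simp: i_def lt3)
  ultimately show "contains_pattern (one_line n p) [3,2,1]"
    unfolding contains_pattern_def by (intro exI[of _ i]) (simp add: numeral_3_eq_3)
qed

text \<open>The four patterns differ only in the relative order of the last large entry and the first small
  entry (\<open>x\<close>: the small one comes first), and in the relative size of the first large entry and the
  last small entry (\<open>y\<close>: the small one is bigger).\<close>

definition gon_pattern :: "bool \<Rightarrow> bool \<Rightarrow> nat \<Rightarrow> nat list" where
  "gon_pattern x y k = [if y then k else k+1] @ [k+2..<2*k] @ (if x then [1, 2*k] else [2*k, 1])
     @ [2..<k] @ [if y then k+1 else k]"

lemma k_gon_patterns_eq:
  assumes "k \<ge> 2"
  shows "k_gon_patterns k = {gon_pattern x y k |x y. True}"
proof -
  have "[k+1..<2*k] = (k+1) # [k+2..<2*k]" "[2..<k+1] = [2..<k] @ [k]"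
    using assms by (simp_all add: upt_conv_Cons numeral_2_eq_2)
  then have "k_gon_patterns k = (\<lambda>(x, y). gon_pattern x y k) ` (UNIV \<times> UNIV)"
    unfolding k_gon_patterns_def UNIV_bool by (auto simp: gon_pattern_def)
  then show ?thesis by auto
qed

lemma length_gon_pattern: "k \<ge> 2 \<Longrightarrow> length (gon_pattern x y k) = 2 * k"
  by (simp add: gon_pattern_def)

lemma nth_gon_pattern:
  assumes "k \<ge> 2" "a < 2 * k"
  shows "gon_pattern x y k ! a =
    (if a = 0 then (if y then k else k+1)
     else if a < k-1 then k+1+a
     else if a = k-1 then (if x then 1 else 2*k)
     else if a = k then (if x then 2*k else 1)
     else if a < 2*k-1 then a-k+1
     else (if y then k+1 else k))"
proof -
  obtain m where k: "k = Suc (Suc m)"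
    using assms(1) by (metis Suc_le_D numeral_2_eq_2 Suc_le_mono)
  have nth: "gon_pattern x y k ! a = (case a of 0 \<Rightarrow> (if y then k else k+1)
      | Suc b \<Rightarrow> if b < m then [k+2..<2*k] ! b
         else ((if x then [1, 2*k] else [2*k, 1]) @ [2..<k] @ [if y then k+1 else k]) ! (b-m))"
  proof -
    define M where "M = [k+2..<2*k]"
    have "length M = m" unfolding M_def k length_upt by simp
    then show ?thesis unfolding gon_pattern_def M_def[symmetric] by (simp add: nth_append split: nat.split)
  qed
  \<comment> \<open>The five blocks of the pattern have lengths 1, \<open>m\<close>, 2,
    \<open>m\<close> and 1.\<close>
  consider "a = 0" | b where "a = Suc b" "b < m" | "a = Suc m" | "a = Suc (Suc m)"
    | b where "a = m + b + 3" "b < m" | "a = 2 * m + 3"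
  proof -
    have "a = 0 \<or> (a = Suc (a - 1) \<and> a - 1 < m) \<or> a = Suc m \<or> a = Suc (Suc m)
        \<or> (a = m + (a - m - 3) + 3 \<and> a - m - 3 < m) \<or> a = 2 * m + 3"
      using assms(2) unfolding k by arith
    then show ?thesis using that by metis
  qed
  then show ?thesis
  proof cases
    case 5
    then have a: "a = Suc (Suc (Suc (m + b)))" by simp
    have "Suc (Suc (m + b)) - m = Suc (Suc b)" by simp
    then show ?thesis unfolding nth unfolding a using \<open>b < m\<close> by (simp add: k nth_append del: upt_Suc)
  next
    case 6
    then have a: "a = Suc (Suc (Suc (m + m)))" by simp
    have "Suc (Suc (m + m)) - m = Suc (Suc m)" by simp
    then show ?thesis unfolding nth unfolding a by (simp add: k nth_append del: upt_Suc)
  qed (unfold nth, simp_all add: k del: upt_Suc)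
qed

text \<open>The positions of the \<open>k\<close> large entries (\<open>u\<close>) and the \<open>k\<close> small entries (\<open>d\<close>) of an occurrence
  of any one of the four patterns: the two comparisons in which the patterns differ are left open.\<close>

definition polygon :: "nat \<Rightarrow> nat \<Rightarrow> (nat \<Rightarrow> nat) \<Rightarrow> (nat \<Rightarrow> nat) \<Rightarrow> (nat \<Rightarrow> nat) \<Rightarrow> bool" where
  "polygon k n p u d \<longleftrightarrow>
     u ` {..<k} \<subseteq> {..<n} \<and> d ` {..<k} \<subseteq> {..<n} \<and>
     strict_mono_on {..<k} u \<and> strict_mono_on {..<k} d \<and>
     strict_mono_on {..<k} (p \<circ> u) \<and> strict_mono_on {..<k} (p \<circ> d) \<and>
     u (k-2) < d 0 \<and> u (k-1) < d 1 \<and> p (d (k-2)) < p (u 0) \<and> p (d (k-1)) < p (u 1)"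

lemma strict_mono_on_lessThan_SucI:
  fixes g :: "nat \<Rightarrow> nat"
  assumes "\<And>a. Suc a < N \<Longrightarrow> g a < g (Suc a)"
  shows "strict_mono_on {..<N} g"
proof -
  have "b < N \<Longrightarrow> a < b \<Longrightarrow> g a < g b" for a b
  proof (induction b)
    case (Suc b)
    then show ?case using assms[of b] by (cases "a = b") auto
  qed simp
  then show ?thesis by (auto simp: strict_mono_on_def)
qed

lemma contains_gon_imp_polygon:
  assumes k: "k \<ge> 3" and "contains_pattern (one_line n p) (gon_pattern x y k)"
  shows "\<exists>u d. polygon k n p u d"
proof -
  have k2: "k \<ge> 2" using k by simp
  obtain i where mono: "strict_mono_on {..<2*k} i" and ran: "i ` {..<2*k} \<subseteq> {..<n}"
    and iso: "\<forall>a<2*k. \<forall>b<2*k. one_line n p ! i a < one_line n p ! i b \<longleftrightarrow>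
                 gon_pattern x y k ! a < gon_pattern x y k ! b"
    using assms(2) length_gon_pattern[OF k2, of x y] unfolding contains_pattern_def by auto
  have ran': "i a < n" if "a < 2*k" for a using ran that by auto
  have less: "p (i a) < p (i b) \<longleftrightarrow> gon_pattern x y k ! a < gon_pattern x y k ! b"
    if "a < 2*k" "b < 2*k" for a b
    using iso that ran' by simp
  have imono: "i a < i b" if "a < b" "b < 2*k" for a b
    using mono that by (auto simp: strict_mono_on_def)
  \<comment> \<open>Positions in the pattern of the \<open>j\<close>-th large and the
    \<open>j\<close>-th small entry. Only the last large and the first small entry depend on
    \<open>x\<close>: they occupy \<open>k-1\<close> and \<open>k\<close> in one order or the
    other.\<close>
  define upos where "upos = (\<lambda>j. if j < k-1 then j else k-1 + of_bool x)"
  define dpos where "dpos = (\<lambda>j. if j = 0 then k - of_bool x else k + j)"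
  have b: "upos j < 2*k" "dpos j < 2*k" if "j < k" for j using that k by (auto simp: upos_def dpos_def)
  have u_mono: "upos a < upos b" "dpos a < dpos b" if "a < b" "b < k" for a b
    using that by (auto simp: upos_def dpos_def)
  have vu: "gon_pattern x y k ! upos j = (if j = 0 then (if y then k else k+1) else k+1+j)" if "j < k" for j
    using that k by (auto simp: upos_def nth_gon_pattern[OF k2])
  have vd: "gon_pattern x y k ! dpos j = (if j = k-1 then (if y then k+1 else k) else j+1)" if jk: "j < k" for j
  proof -
    consider "j = 0" | "0 < j" "j < k-1" | "0 < j" "j = k-1" using jk k by linarith
    then show ?thesis
    proof cases
      case 1
      then show ?thesis using k by (cases x) (auto simp: dpos_def nth_gon_pattern[OF k2])
    next
      case 2
      then have "k < k + j" "k + j < 2*k-1" by linarith+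
      then show ?thesis using 2 k by (auto simp: dpos_def nth_gon_pattern[OF k2])
    next
      case 3
      have "\<not> 2*k-1 < k-1" "2*k-1 \<noteq> k-1" "2*k-1 \<noteq> k" "dpos j = 2*k-1" using 3 k by (auto simp: dpos_def)
      then show ?thesis using 3 k by (simp add: nth_gon_pattern[OF k2])
    qed
  qed
  have "polygon k n p (i \<circ> upos) (i \<circ> dpos)"
    unfolding polygon_def
  proof (intro conjI)
    show "strict_mono_on {..<k} (p \<circ> (i \<circ> upos))" "strict_mono_on {..<k} (p \<circ> (i \<circ> dpos))"
      by (auto simp: strict_mono_on_def less b vu vd)
    show "p ((i \<circ> dpos) (k-2)) < p ((i \<circ> upos) 0)" "p ((i \<circ> dpos) (k-1)) < p ((i \<circ> upos) 1)"
      using k by (auto simp: less b vu vd)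
    show "(i \<circ> upos) (k - 2) < (i \<circ> dpos) 0" "(i \<circ> upos) (k - 1) < (i \<circ> dpos) 1"
      using k by (auto simp: upos_def dpos_def intro!: imono)
  qed (auto simp: strict_mono_on_def intro!: ran' imono u_mono b)
  then show ?thesis by blast
qed

text \<open>A polygon leaves open just the comparisons of \<open>u (k-1)\<close> with
  \<open>d 0\<close> and of \<open>p (u 0)\<close> with \<open>p (d (k-1))\<close>. Neither can be a
  tie, so their outcomes \<open>x\<close> and \<open>y\<close> select the pattern that
  occurs.\<close>

lemma polygon_imp_contains_gon:
  assumes k: "k \<ge> 3" and inj: "inj_on p {..<n}" and "polygon k n p u d"
  shows "\<exists>x y. contains_pattern (one_line n p) (gon_pattern x y k)"
proof -
  have k2: "k \<ge> 2" using k by simp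
  have ran: "\<And>j. j < k \<Longrightarrow> u j < n" "\<And>j. j < k \<Longrightarrow> d j < n"
    and mono: "\<And>a b. a < b \<Longrightarrow> b < k \<Longrightarrow> u a < u b" "\<And>a b. a < b \<Longrightarrow> b < k \<Longrightarrow> d a < d b"
      "\<And>a b. a < b \<Longrightarrow> b < k \<Longrightarrow> p (u a) < p (u b)" "\<And>a b. a < b \<Longrightarrow> b < k \<Longrightarrow> p (d a) < p (d b)"
    and c: "u (k-2) < d 0" "u (k-1) < d 1" "p (d (k-2)) < p (u 0)" "p (d (k-1)) < p (u 1)"
    using assms(3) unfolding polygon_def strict_mono_on_def by auto
  define x where "x \<longleftrightarrow> d 0 < u (k-1)"
  define y where "y \<longleftrightarrow> p (u 0) < p (d (k-1))"
  have ne: "u a \<noteq> d b \<and> p (u a) \<noteq> p (d b)" if ab: "a < k" "b < k" for a b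
  proof -
    \<comment> \<open>The inequalities between positions separate \<open>u a\<close> from
      \<open>d b\<close>, except for \<open>u (k-1)\<close> and \<open>d 0\<close>, whose values
      differ.\<close>
    have "u a \<noteq> d b"
    proof (cases "a \<le> k-2")
      case True
      have "u a \<le> u (k-2)" using mono(1)[of a "k-2"] True k by (cases "a = k-2") auto
      moreover have "d 0 \<le> d b" using mono(2)[of 0 b] ab by (cases "b = 0") auto
      ultimately show ?thesis using c by linarith
    next
      case False
      then have a: "a = k-1" using ab by simp
      show ?thesis
      proof (cases "b = 0")
        case True
        have "p (d 0) < p (u 0)" using mono(4)[of 0 "k-2"] k c by simp
        also have "p (u 0) < p (u a)" using mono(3)[of 0 a] a k by simp
        finally show ?thesis using True by auto
      next
        case False
        then have "d 1 \<le> d b" using mono(2)[of 1 b] ab by (cases "b = 1") auto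
        then show ?thesis using c a by simp
      qed
    qed
    then show ?thesis using inj_onD[OF inj, of "u a" "d b"] ran ab by auto
  qed
  \<comment> \<open>\<open>i\<close> lists the chosen positions and \<open>vs\<close> the chosen
    values, both in increasing order. Claim \<open>pi\<close> then says that the pattern entry at
    \<open>a\<close>, less one because entries count from 1, is the index of \<open>p (i a)\<close>
    in \<open>vs\<close>.\<close>
  define i where "i = (\<lambda>a. if a < k-1 then u a
    else if a = k-1 then (if x then d 0 else u (k-1))
    else if a = k then (if x then u (k-1) else d 0) else d (a-k))"
  define vs where "vs = (\<lambda>r. if r < k-1 then p (d r)
    else if r = k-1 then (if y then p (u 0) else p (d (k-1)))
    else if r = k then (if y then p (d (k-1)) else p (u 0)) else p (u (r-k)))"
  have mi: "strict_mono_on {..<2*k} i"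
  proof (rule strict_mono_on_lessThan_SucI)
    fix a assume a: "Suc a < 2*k"
    consider "a < k-2" | "a = k-2" | "a = k-1" | "a = k" | "a > k" by linarith
    then show "i a < i (Suc a)"
    proof cases
      case 2 then show ?thesis using c mono(1)[of "k-2" "k-1"] k by (auto simp: i_def Suc_diff_le)
    next
      case 3 then show ?thesis using ne[of "k-1" 0] k by (auto simp: i_def x_def)
    next
      case 4 then show ?thesis using c mono(2)[of 0 1] k by (auto simp: i_def)
    next
      case 5 then show ?thesis using mono(2)[of "a-k" "Suc a - k"] a by (auto simp: i_def)
    qed (use mono(1)[of a "Suc a"] k in \<open>auto simp: i_def\<close>)
  qed
  have mvs: "strict_mono_on {..<2*k} vs"
  proof (rule strict_mono_on_lessThan_SucI)
    fix a assume a: "Suc a < 2*k"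
    consider "a < k-2" | "a = k-2" | "a = k-1" | "a = k" | "a > k" by linarith
    then show "vs a < vs (Suc a)"
    proof cases
      case 2 then show ?thesis using c mono(4)[of "k-2" "k-1"] k by (auto simp: vs_def Suc_diff_le)
    next
      case 3 then show ?thesis using ne[of 0 "k-1"] k by (auto simp: vs_def y_def)
    next
      case 4 then show ?thesis using c mono(3)[of 0 1] k by (auto simp: vs_def)
    next
      case 5 then show ?thesis using mono(3)[of "a-k" "Suc a - k"] a by (auto simp: vs_def)
    qed (use mono(4)[of a "Suc a"] k in \<open>auto simp: vs_def\<close>)
  qed
  have ri: "i a < n" if "a < 2*k" for a using that ran by (auto simp: i_def)
  have pi: "p (i a) = vs (gon_pattern x y k ! a - 1) \<and> gon_pattern x y k ! a - 1 < 2*k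
      \<and> gon_pattern x y k ! a > 0" if ak: "a < 2*k" for a
  proof -
    consider "a = 0" | "0 < a" "a < k-1" | "a = k-1" | "a = k" | "k < a" "a < 2*k-1" | "a = 2*k-1"
      using ak k by linarith
    then show ?thesis
    proof cases
      case 5
      then have "\<not> a < k-1" "a \<noteq> k-1" "a \<noteq> k" "a-k < k-1" by auto
      moreover from this have "i a = d (a-k)" by (simp add: i_def)
      ultimately show ?thesis using 5 k by (simp add: vs_def nth_gon_pattern[OF k2])
    next
      case 6
      then have "\<not> a < k-1" "a \<noteq> k-1" "a \<noteq> k" using k by auto
      moreover from this have "i a = d (k-1)" using 6 by (simp add: i_def)
      ultimately show ?thesis using 6 k by (auto simp add: vs_def nth_gon_pattern[OF k2])
    next
      case 3
      have "2*k-1-k = k-1" "\<not> 2*k-1 < k-1" "2*k-1 \<noteq> k-1" "2*k-1 \<noteq> k" using k by auto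
      then show ?thesis using 3 k by (simp add: i_def vs_def nth_gon_pattern[OF k2])
    next
      case 4
      have "2*k-1-k = k-1" "\<not> 2*k-1 < k-1" "2*k-1 \<noteq> k-1" "2*k-1 \<noteq> k" using k by auto
      moreover have "i a = (if x then u (k-1) else d 0)" using 4 k by (auto simp: i_def)
      moreover have "gon_pattern x y k ! a = (if x then 2*k else 1)" using 4 k by (auto simp: nth_gon_pattern[OF k2])
      ultimately show ?thesis using k by (simp add: vs_def)
    qed (use k in \<open>auto simp: i_def vs_def nth_gon_pattern[OF k2]\<close>)
  qed
  have "contains_pattern (one_line n p) (gon_pattern x y k)"
    unfolding contains_pattern_def length_gon_pattern[OF k2]
  proof (intro exI[of _ i] conjI allI impI)
    fix a b assume "a < 2*k" "b < 2*k"
    moreover have "vs (gon_pattern x y k ! a - 1) < vs (gon_pattern x y k ! b - 1) \<longleftrightarrow>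
        gon_pattern x y k ! a - 1 < gon_pattern x y k ! b - 1"
      using calculation by (intro strict_mono_on_less[OF mvs]) (use pi[of a] pi[of b] in auto)
    moreover have "gon_pattern x y k ! a - 1 < gon_pattern x y k ! b - 1 \<longleftrightarrow>
        gon_pattern x y k ! a < gon_pattern x y k ! b"
      using pi[of a] pi[of b] calculation by linarith
    ultimately show "one_line n p ! i a < one_line n p ! i b \<longleftrightarrow> gon_pattern x y k ! a < gon_pattern x y k ! b"
      by (simp add: ri pi)
  qed (use mi ri in auto)
  then show ?thesis by blast
qed

lemma k_gon_avoiding_iff:
  assumes "k \<ge> 3" "inj_on p {..<n}"
  shows "k_gon_avoiding k (one_line n p) \<longleftrightarrow> (\<nexists>u d. polygon k n p u d)"
proof -
  have "k_gon_avoiding k (one_line n p) \<longleftrightarrow>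
      \<not> (\<exists>x y. contains_pattern (one_line n p) (gon_pattern x y k))"
    using assms(1) by (auto simp: k_gon_avoiding_def avoids_def k_gon_patterns_eq)
  then show ?thesis
    using contains_gon_imp_polygon[OF assms(1)] polygon_imp_contains_gon[OF assms] by blast
qed

section \<open>Heights of 321-avoiding permutations\<close>

definition height :: "(nat \<Rightarrow> nat) \<Rightarrow> nat \<Rightarrow> nat" where
  "height p t = card {i. i < t \<and> t \<le> p i}"

lemma card_Collect_less_Suc:
  "card {i. i < Suc t \<and> P i} = card {i. i < t \<and> P i} + of_bool (P t)"
proof -
  have "{i. i < Suc t \<and> P i} = (if P t then insert t {i. i < t \<and> P i} else {i. i < t \<and> P i})"
    by (auto simp: less_Suc_eq)
  then show ?thesis by simp
qed

locale finite_perm =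
  fixes n :: nat and p :: "nat \<Rightarrow> nat"
  assumes perm: "p permutes {..<n}"
begin

lemma less_iff [simp]: "p i < n \<longleftrightarrow> i < n"
  using permutes_in_image[OF perm, of i] by simp

lemma inj: "inj p"
  using perm by (rule permutes_inj)

lemma p_inv [simp]: "p (inv p v) = v"
  using permutes_inverses(1)[OF perm] .

lemma inv_p [simp]: "inv p (p i) = i"
  using permutes_inverses(2)[OF perm] .

lemma finite_preimage_less [simp]: "finite {i. p i < t}"
proof -
  have "{i. p i < t} = inv p ` {..<t}"
    by (auto simp: image_iff) (metis inv_p lessThan_iff)
  then show ?thesis by simp
qed

lemma card_preimage_less: "card {i. p i < t} = t"
proof -
  have "{..<t} = p ` {i. p i < t}"
    by (auto simp: image_iff) (metis p_inv)
  moreover have "card (p ` {i. p i < t}) = card {i. p i < t}"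
    using inj by (intro card_image) (auto simp: inj_on_def)
  ultimately show ?thesis by (metis card_lessThan)
qed

text \<open>Exactly \<open>t\<close> positions and exactly \<open>t\<close> values lie below
  \<open>t\<close>. Discarding the entries with both below \<open>t\<close> leaves equally many on
  either side.\<close>

lemma height_eq_card_lower: "height p t = card {i. t \<le> i \<and> p i < t}"
proof -
  have "card {i. p i < t} = card {i. i < t \<and> p i < t} + card {i. t \<le> i \<and> p i < t}"
    by (subst card_Un_disjoint[symmetric])
      (auto intro!: arg_cong[where f = card] finite_subset[OF _ finite_preimage_less[of t]])
  moreover have "card {..<t} = card {i. i < t \<and> p i < t} + card {i. i < t \<and> t \<le> p i}"
  proof -
    have *: "{..<t} = {i. i < t \<and> p i < t} \<union> {i. i < t \<and> t \<le> p i}" by auto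
    show ?thesis unfolding * by (rule card_Un_disjoint) auto
  qed
  ultimately show ?thesis by (simp add: card_preimage_less height_def)
qed

text \<open>A large entry is open from its position to its value, so those with value below
  \<open>t\<close> are subtracted; the value \<open>v\<close> belongs to a large entry iff
  \<open>inv p v \<le> v\<close>. Both counts run over an initial segment, which yields the step
  rule \<open>height_Suc\<close>.\<close>

lemma height_eq_diff:
  "int (height p t) = int (card {i. i < t \<and> i \<le> p i}) - int (card {v. v < t \<and> inv p v \<le> v})"
proof -
  have "{v. v < t \<and> inv p v \<le> v} = p ` {i. i \<le> p i \<and> p i < t}"
    by (auto simp: image_iff) (metis p_inv)
  then have "card {v. v < t \<and> inv p v \<le> v} = card {i. i \<le> p i \<and> p i < t}"
    using inj by (simp add: card_image inj_on_def)
  moreover have "card {i. i < t \<and> i \<le> p i} = card {i. i \<le> p i \<and> p i < t} + card {i. i < t \<and> t \<le> p i}"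
    by (subst card_Un_disjoint[symmetric])
      (auto intro!: arg_cong[where f = card] finite_subset[OF _ finite_preimage_less[of t]])
  ultimately show ?thesis by (simp add: height_def)
qed

lemma height_Suc:
  "height p (Suc t) + of_bool (inv p t \<le> t) = height p t + of_bool (t \<le> p t)"
proof -
  show ?thesis
    using height_eq_diff[of t] height_eq_diff[of "Suc t"]
    by (simp only: card_Collect_less_Suc)
qed

lemma height_beyond: "n \<le> t \<Longrightarrow> height p t = 0"
proof -
  assume "n \<le> t"
  then have "p i = i" if "t \<le> i" for i using permutes_not_in[OF perm, of i] that by simp
  then have "{i. t \<le> i \<and> p i < t} = {}" by auto
  then show ?thesis by (simp only: height_eq_card_lower card.empty)
qed

lemma height_ge_upper:
  assumes "finite J" "inj_on u J" "\<And>j. j \<in> J \<Longrightarrow> u j < t \<and> t \<le> p (u j)"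
  shows "card J \<le> height p t"
proof -
  have "card J = card (u ` J)" using assms by (simp add: card_image)
  also have "\<dots> \<le> height p t" unfolding height_def using assms by (intro card_mono) auto
  finally show ?thesis .
qed

lemma height_ge_lower:
  assumes "finite J" "inj_on d J" "\<And>j. j \<in> J \<Longrightarrow> t \<le> d j \<and> p (d j) < t"
  shows "card J \<le> height p t"
proof -
  have "card J = card (d ` J)" using assms by (simp add: card_image)
  also have "\<dots> \<le> height p t" unfolding height_eq_card_lower using assms
    by (intro card_mono finite_subset[OF _ finite_preimage_less[of t]]) auto
  finally show ?thesis .
qed

end

text \<open>321-avoidance in the form that the paths need; \<open>perm_321_avoiding_iff\<close>
  relates it to occurrences of 321.\<close>

locale perm_321_avoiding = finite_perm +
  assumes upper_mono: "\<And>i j. i < j \<Longrightarrow> j < n \<Longrightarrow> i \<le> p i \<Longrightarrow> j \<le> p j \<Longrightarrow> p i < p j"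
    and lower_mono: "\<And>i j. i < j \<Longrightarrow> j < n \<Longrightarrow> p i < i \<Longrightarrow> p j < j \<Longrightarrow> p i < p j"
begin

lemma inversion:
  assumes "i < j" "j < n" "p j < p i"
  shows "i \<le> p i" "p j < j"
proof -
  show "i \<le> p i"
    using lower_mono[of i j] assms by (cases "j \<le> p j"; force simp: not_le)
  then show "p j < j"
    using upper_mono[of i j] assms by (cases "j \<le> p j"; force simp: not_le)
qed

end

text \<open>In an occurrence of 321 the middle entry would be small as the end of one inversion and
  large as the start of another. The converse counts the values on either side of an
  inversion.\<close>

lemma perm_321_avoiding_iff:
  assumes "p permutes {..<n}"
  shows "perm_321_avoiding n p \<longleftrightarrow> \<not> (\<exists>a b c. a < b \<and> b < c \<and> c < n \<and> p c < p b \<and> p b < p a)"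
proof
  assume "perm_321_avoiding n p"
  then interpret perm_321_avoiding n p .
  show "\<not> (\<exists>a b c. a < b \<and> b < c \<and> c < n \<and> p c < p b \<and> p b < p a)"
    using inversion by (meson leD less_trans)
next
  assume av: "\<not> (\<exists>a b c. a < b \<and> b < c \<and> c < n \<and> p c < p b \<and> p b < p a)"
  interpret finite_perm n p by unfold_locales fact
  \<comment> \<open>Avoidance forces all values below \<open>p j\<close> into the positions before
    \<open>j\<close> other than \<open>i\<close>, so \<open>p j < j\<close>. Dually, all values
    above \<open>p i\<close> lie after \<open>i\<close> and not at \<open>j\<close>, so
    \<open>i < p i\<close>.\<close>
  have inv: "i < p i \<and> p j < j" if ij: "i < j" "j < n" "p j < p i" for i j
  proof
    have "inj_on p S" for S using inj by (rule inj_on_subset) simp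
    then have cimg: "card (p ` S) = card S" for S by (rule card_image)
    have "{..<p j} \<subseteq> p ` ({..<j} - {i})"
    proof
      fix v assume v: "v \<in> {..<p j}"
      define l where "l = inv p v"
      have l: "p l = v" by (simp add: l_def)
      have "v < p j" using v by simp
      also have "p j < n" using ij by simp
      finally have "v < n" .
      then have "l < n" using l less_iff[of l] by simp
      have "\<not> j < l" using av ij v l \<open>l < n\<close> by auto
      moreover have "l \<noteq> j" "l \<noteq> i" using v l ij by auto
      ultimately show "v \<in> p ` ({..<j} - {i})" using l by (auto simp: image_iff)
    qed
    then have "card {..<p j} \<le> card (p ` ({..<j} - {i}))" by (rule card_mono[rotated]) simp
    also have "\<dots> = j - 1" using ij by (simp add: cimg)
    finally show "p j < j" using ij by simp
    have "{p i<..<n} \<subseteq> p ` ({i<..<n} - {j})"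
    proof
      fix v assume v: "v \<in> {p i<..<n}"
      define l where "l = inv p v"
      have l: "p l = v" by (simp add: l_def)
      then have "l < n" using v less_iff[of l] by simp
      have "\<not> l < i" using av ij v l by auto
      moreover have "l \<noteq> j" "l \<noteq> i" using v l ij by auto
      ultimately show "v \<in> p ` ({i<..<n} - {j})" using l \<open>l < n\<close> by (auto simp: image_iff)
    qed
    then have "card {p i<..<n} \<le> card (p ` ({i<..<n} - {j}))" by (rule card_mono[rotated]) simp
    also have "\<dots> = n - Suc i - 1" using ij by (simp add: cimg)
    finally show "i < p i" using ij by simp
  qed
  show "perm_321_avoiding n p"
  proof
    fix i j assume ij: "i < j" "j < n"
    have "p i \<noteq> p j" using ij inj by (auto dest: injD)
    then have "p i < p j \<or> (i < p i \<and> p j < j)" using inv[OF ij] by linarith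
    then show "i \<le> p i \<Longrightarrow> j \<le> p j \<Longrightarrow> p i < p j" "p i < i \<Longrightarrow> p j < j \<Longrightarrow> p i < p j"
      by linarith+
  qed
qed

text \<open>The second condition forbids leaving height \<open>m\<close> by a down step and returning at once, and a pair
  of consecutive level steps of different kinds at height \<open>m\<close>.\<close>

definition low_heights :: "nat \<Rightarrow> nat \<Rightarrow> (nat \<Rightarrow> nat) \<Rightarrow> bool" where
  "low_heights m n p \<longleftrightarrow> (\<forall>t\<le>n. height p t \<le> m) \<and>
     (\<forall>t. t + 2 \<le> n \<longrightarrow> height p t = m \<longrightarrow> height p (t + 2) = m \<longrightarrow> (t \<le> p t \<longleftrightarrow> t + 1 \<le> p (t + 1)))"

section \<open>Polygons and the height conditions\<close>

context perm_321_avoiding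
begin

text \<open>Let \<open>t\<close> be the first time by which the first \<open>k - 1\<close> large and small entries of the polygon have
  been opened, and \<open>t'\<close> the same for all \<open>k\<close> of them. Both have height \<open>k - 1\<close>. At any time in between,
  \<open>k - 2\<close> of its large entries or \<open>k - 2\<close> of its small ones are open, and the only possible step from
  height \<open>k - 2\<close> is an up step. As a down step from height \<open>k - 1\<close> may not be followed by an up step,
  the path stays at height \<open>k - 1\<close> between \<open>t\<close> and \<open>t'\<close>, with level steps of one kind only; but both a
  large and a small entry are opened there.\<close>

lemma polygon_imp_not_low_heights:
  assumes k: "k \<ge> 3" and "polygon k n p u d"
  shows "\<not> low_heights (k-1) n p"
proof
  assume low: "low_heights (k-1) n p"
  have ran: "\<And>j. j < k \<Longrightarrow> u j < n" "\<And>j. j < k \<Longrightarrow> d j < n"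
    and mono: "\<And>a b. a < b \<Longrightarrow> b < k \<Longrightarrow> u a < u b" "\<And>a b. a < b \<Longrightarrow> b < k \<Longrightarrow> d a < d b"
      "\<And>a b. a < b \<Longrightarrow> b < k \<Longrightarrow> p (u a) < p (u b)" "\<And>a b. a < b \<Longrightarrow> b < k \<Longrightarrow> p (d a) < p (d b)"
    and c: "u (k-2) < d 0" "u (k-1) < d 1" "p (d (k-2)) < p (u 0)" "p (d (k-1)) < p (u 1)"
    using assms(2) unfolding polygon_def strict_mono_on_def by auto
  have injud: "inj_on u J" "inj_on d J" if "J \<subseteq> {..<k}" for J
    using that mono by (auto simp: inj_on_def subset_iff) (metis less_irrefl linorder_neqE_nat)+
  have le: "u a \<le> u b" "d a \<le> d b" "p (u a) \<le> p (u b)" "p (d a) \<le> p (d b)" if "a \<le> b" "b < k" for a b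
    using that mono[of a b] by (cases "a = b"; simp)+
  have HU: "card J \<le> height p t" if "J \<subseteq> {..<k}" "\<And>j. j \<in> J \<Longrightarrow> u j < t \<and> t \<le> p (u j)" for J t
    using that injud[of J] by (intro height_ge_upper[of J u]) (auto intro: finite_subset)
  have HD: "card J \<le> height p t" if "J \<subseteq> {..<k}" "\<And>j. j \<in> J \<Longrightarrow> t \<le> d j \<and> p (d j) < t" for J t
    using that injud[of J] by (intro height_ge_lower[of J d]) (auto intro: finite_subset)
  have hle: "height p t \<le> k-1" for t
    using low height_beyond[of t] unfolding low_heights_def by (cases "t \<le> n") auto
  \<comment> \<open>Because of this, \<open>d 1\<close> is among the first \<open>k-1\<close> small
    entries and forms an inversion with \<open>u (k-1)\<close>, and likewise \<open>u 1\<close> with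
    \<open>d (k-1)\<close>. Hence \<open>u (k-1)\<close> is indeed large and \<open>d (k-1)\<close>
    small.\<close>
  have "1 \<le> k-2" using k by linarith
  have upper: "u (k-1) \<le> p (u (k-1))"
    using inversion(1)[of "u (k-1)" "d 1"] c ran le(4)[of 1 "k-2"] le(3)[of 0 "k-1"] k \<open>1 \<le> k-2\<close> by simp
  have lower: "p (d (k-1)) < d (k-1)"
    using inversion(2)[of "u 1" "d (k-1)"] c ran le(1)[of 1 "k-2"] le(2)[of 0 "k-1"] k \<open>1 \<le> k-2\<close> by simp

  \<comment> \<open>A large entry opens at its position and a small one at its value; adding 1 puts
    the opening strictly before the time.\<close>
  define t where "t = max (u (k-2)) (p (d (k-2))) + 1"
  define t' where "t' = max (u (k-1)) (p (d (k-1))) + 1"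
  have t'n: "t' \<le> n" using ran[of "k-1"] k by (simp add: t'_def Suc_le_eq)
  have "u (k-2) < u (k-1)" "p (d (k-2)) < p (d (k-1))" using mono k by simp_all
  then have tt': "t < t'" by (auto simp: t_def t'_def)
  have tu: "u j < t" "p (d j) < t" if "j \<le> k-2" for j
    using le(1)[of j "k-2"] le(4)[of j "k-2"] that k by (simp_all add: t_def less_Suc_eq_le le_max_iff_disj)
  \<comment> \<open>Otherwise \<open>t = u (k-2) + 1 \<le> d 0\<close> and all \<open>k\<close>
    small entries are open at \<open>t\<close>, against the bound \<open>k-1\<close>. Claim
    \<open>pt\<close> is dual.\<close>
  have wt: "t \<le> p (d (k-1))"
  proof (rule ccontr)
    assume "\<not> t \<le> p (d (k-1))"
    then have *: "p (d (k-1)) < t" and t: "t = u (k-2) + 1"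
      using \<open>p (d (k-2)) < p (d (k-1))\<close> by (auto simp: t_def max_def split: if_splits)
    have "card {..<k} \<le> height p t"
    proof (rule HD)
      fix j assume "j \<in> {..<k}"
      then have "j < k" "j \<le> k-1" by auto
      then show "t \<le> d j \<and> p (d j) < t" using * t c(1) le(2)[of 0 j] le(4)[of j "k-1"] by linarith
    qed auto
    then show False using hle[of t] k by simp
  qed
  have pt: "t \<le> u (k-1)"
  proof (rule ccontr)
    assume "\<not> t \<le> u (k-1)"
    then have *: "u (k-1) < t" and t: "t = p (d (k-2)) + 1"
      using \<open>u (k-2) < u (k-1)\<close> by (auto simp: t_def max_def split: if_splits)
    have "card {..<k} \<le> height p t"
    proof (rule HU)
      fix j assume "j \<in> {..<k}"
      then have "j < k" "j \<le> k-1" by auto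
      then show "u j < t \<and> t \<le> p (u j)" using * t c(3) le(3)[of 0 j] le(1)[of j "k-1"] by linarith
    qed auto
    then show False using hle[of t] k by simp
  qed
  \<comment> \<open>If the maximum in \<open>t\<close> is attained by the position, the first
    \<open>k-1\<close> small entries are open at \<open>t\<close>, otherwise the first
    \<open>k-1\<close> large ones. In \<open>ht'\<close> the indices \<open>{1..<k}\<close> take
    this role.\<close>
  have ht: "height p t = k-1"
  proof (cases "u (k-2) \<ge> p (d (k-2))")
    case True
    have "card {..<k-1} \<le> height p t"
    proof (rule HD)
      fix j assume "j \<in> {..<k-1}"
      then have "j < k" "j \<le> k-2" by auto
      then show "t \<le> d j \<and> p (d j) < t" using tu(2)[of j] True c(1) le(2)[of 0 j] by (simp add: t_def)
    qed auto
    then show ?thesis using hle[of t] by simp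
  next
    case False
    have "card {..<k-1} \<le> height p t"
    proof (rule HU)
      fix j assume "j \<in> {..<k-1}"
      then have "j < k" "j \<le> k-2" by auto
      then show "u j < t \<and> t \<le> p (u j)" using tu(1)[of j] False c(3) le(3)[of 0 j] by (simp add: t_def)
    qed auto
    then show ?thesis using hle[of t] by simp
  qed
  have ht': "height p t' = k-1"
  proof (cases "u (k-1) \<ge> p (d (k-1))")
    case True
    have "card {1..<k} \<le> height p t'"
    proof (rule HD)
      fix j assume "j \<in> {1..<k}"
      then have "j < k" "j \<le> k-1" "1 \<le> j" by auto
      then show "t' \<le> d j \<and> p (d j) < t'" using True c(2) le(2)[of 1 j] le(4)[of j "k-1"] by (simp add: t'_def)
    qed auto
    then show ?thesis using hle[of t'] by simp
  next
    case False
    have "card {1..<k} \<le> height p t'"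
    proof (rule HU)
      fix j assume "j \<in> {1..<k}"
      then have "j < k" "j \<le> k-1" "1 \<le> j" by auto
      then show "u j < t' \<and> t' \<le> p (u j)" using False c(4) le(3)[of 1 j] le(1)[of j "k-1"] by (simp add: t'_def)
    qed auto
    then show ?thesis using hle[of t'] by simp
  qed
  have openu: "u j < s \<and> s \<le> p (u j)" if "1 \<le> j" "j \<le> k-2" "t \<le> s" "s \<le> p (d (k-1)) + 1" for j s
  proof -
    have "j < k" using that k by linarith
    then show ?thesis using tu(1)[of j] le(3)[of 1 j] c(4) that by auto
  qed
  have opend: "s \<le> d j \<and> p (d j) < s" if "1 \<le> j" "j \<le> k-2" "t \<le> s" "s \<le> u (k-1) + 1" for j s
  proof -
    have "j < k" using that k by linarith
    then show ?thesis using tu(2)[of j] le(2)[of 1 j] c(2) that by auto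
  qed
  \<comment> \<open>The large entries with indices from 1 to \<open>k-2\<close> stay open up to
    \<open>p (d (k-1)) + 1\<close>, the small ones up to \<open>u (k-1) + 1\<close>, and
    \<open>t'\<close> is one of these two times.\<close>
  have ge: "k-2 \<le> height p s" if "t \<le> s" "s \<le> t'" for s
  proof (cases "s \<le> p (d (k-1)) + 1")
    case True
    have "card {1..<k-1} \<le> height p s" by (rule HU) (use openu that True in auto)
    then show ?thesis by simp
  next
    case False
    then have "s \<le> u (k-1) + 1" using that by (auto simp: t'_def)
    then have "card {1..<k-1} \<le> height p s" by (intro HD) (use opend that in auto)
    then show ?thesis by simp
  qed
  have all_u: False if s: "height p s = k-2" "p (d (k-1)) < s" "s \<le> u (k-1)" for s
  proof -
    have "card {1..<k} \<le> height p s"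
    proof (rule HD)
      fix j assume "j \<in> {1..<k}"
      then have "j < k" "j \<le> k-1" "1 \<le> j" by auto
      then show "s \<le> d j \<and> p (d j) < s" using s c(2) le(2)[of 1 j] le(4)[of j "k-1"] by simp
    qed auto
    then show False using s k by simp
  qed
  have all_d: False if s: "height p s = k-2" "u (k-1) < s" "s \<le> p (d (k-1))" for s
  proof -
    have "card {1..<k} \<le> height p s"
    proof (rule HU)
      fix j assume "j \<in> {1..<k}"
      then have "j < k" "j \<le> k-1" "1 \<le> j" by auto
      then show "u j < s \<and> s \<le> p (u j)" using s c(4) le(3)[of 1 j] le(1)[of j "k-1"] by simp
    qed auto
    then show False using s k by simp
  qed
  have up: "s \<le> p s \<and> height p (Suc s) = k-1" if s: "t \<le> s" "s < t'" "height p s = k-2" for s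
  proof -
    have "s < n" using s t'n by simp
    \<comment> \<open>If \<open>s\<close> were the value of a large entry, that entry would be open
      together with \<open>u 1\<close>, ..., \<open>u (k-2)\<close>, making the height at least
      \<open>k-1\<close>. In \<open>noF\<close>, a small entry at position \<open>s\<close> would be
      open together with \<open>d 1\<close>, ..., \<open>d (k-2)\<close>.\<close>
    have noE: False if "inv p s \<le> s"
    proof -
      define i where "i = inv p s"
      have i: "p i = s" "i \<le> s" "i < n" using that \<open>s < n\<close> by (simp_all add: i_def)
      have sw: "s \<le> p (d (k-1))"
        using all_u[of s] s by (cases "s \<le> p (d (k-1))") (auto simp: t'_def less_Suc_eq_le le_max_iff_disj)
      have "i < u 1"
      proof (rule ccontr)
        assume "\<not> i < u 1"
        moreover have "u 1 \<noteq> i" using i sw c(4) by auto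
        moreover have "u 1 \<le> p (u 1)" using openu[of 1 s] s sw \<open>1 \<le> k-2\<close> by simp
        ultimately have "p (u 1) < p i" using i by (intro upper_mono) auto
        then show False using i sw c(4) by simp
      qed
      define v where "v = (\<lambda>j. if j = 0 then i else u j)"
      have less: "i < u j" if "1 \<le> j" "j < k" for j using le(1)[of 1 j] that \<open>i < u 1\<close> by simp
      have "v a < v b" if "a < b" "b < k-1" for a b
        using that mono(1)[of a b] less[of b] by (auto simp: v_def)
      then have "inj_on v {..<k-1}"
        by (intro linorder_inj_onI') (metis lessThan_iff less_irrefl)
      then have "card {..<k-1} \<le> height p s"
      proof (rule height_ge_upper[rotated])
        fix j assume "j \<in> {..<k-1}"
        then show "v j < s \<and> s \<le> p (v j)"
          using openu[of j s] openu[of 1 s] s sw i \<open>i < u 1\<close> \<open>1 \<le> k-2\<close> by (auto simp: v_def)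
      qed auto
      then show False using s k by simp
    qed
    have noF: False if "p s < s"
    proof -
      have sp: "s \<le> u (k-1)"
        using all_d[of s] s by (cases "s \<le> u (k-1)") (auto simp: t'_def less_Suc_eq_le le_max_iff_disj)
      have "s < d 1" using sp c(2) by simp
      define v where "v = (\<lambda>j. if j = 0 then s else d j)"
      have less: "s < d j" if "1 \<le> j" "j < k" for j using le(2)[of 1 j] that \<open>s < d 1\<close> by simp
      have "v a < v b" if "a < b" "b < k-1" for a b
        using that mono(2)[of a b] less[of b] by (auto simp: v_def)
      then have "inj_on v {..<k-1}"
        by (intro linorder_inj_onI') (metis lessThan_iff less_irrefl)
      then have "card {..<k-1} \<le> height p s"
      proof (rule height_ge_lower[rotated])
        fix j assume "j \<in> {..<k-1}"
        then show "s \<le> v j \<and> p (v j) < s"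
          using opend[of j s] s sp that k by (auto simp: v_def)
      qed auto
      then show False using s k by simp
    qed
    have "\<not> inv p s \<le> s" "s \<le> p s" using noE noF not_less by blast+
    then show ?thesis using height_Suc[of s] s k by simp
  qed
  have top: "height p s = k-1" if "t \<le> s" "s \<le> t'" for s
    using that
  proof (induction s rule: dec_induct)
    case base then show ?case using ht by simp
  next
    case (step s)
    show ?case
    proof (rule ccontr)
      assume ne: "height p (Suc s) \<noteq> k-1"
      have h: "height p s = k-1" using step by simp
      have h': "height p (Suc s) = k-2" using ne hle[of "Suc s"] ge[of "Suc s"] step by simp
      have "Suc s < t'" using ne ht' step by (cases "Suc s = t'") auto
      then have "Suc s \<le> p (Suc s)" "height p (Suc (Suc s)) = k-1" using up[of "Suc s"] h' step by auto
      moreover have "\<not> s \<le> p s" using height_Suc[of s] h h' k by (cases "inv p s \<le> s") auto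
      moreover have "height p (s+2) = k-1 \<Longrightarrow> s \<le> p s \<longleftrightarrow> s + 1 \<le> p (s + 1)"
        using low h \<open>Suc s < t'\<close> t'n unfolding low_heights_def by simp
      ultimately show False by simp
    qed
  qed
  have same: "(s \<le> p s) = (t \<le> p t)" if "t \<le> s" "s < t'" for s
    using that
  proof (induction s rule: dec_induct)
    case (step s)
    have "height p s = k-1" "height p (s+2) = k-1" "s + 2 \<le> n"
      using top[of s] top[of "s+2"] step t'n by simp_all
    then have "s \<le> p s \<longleftrightarrow> s + 1 \<le> p (s + 1)"
      using low unfolding low_heights_def by blast
    then show ?case using step by simp
  qed simp
  have flat: "inv p s \<le> s \<longleftrightarrow> s \<le> p s" if "t \<le> s" "s < t'" for s
    using height_Suc[of s] top[of s] top[of "Suc s"] that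
    by (cases "inv p s \<le> s"; cases "s \<le> p s") simp_all
  \<comment> \<open>The step at time \<open>u (k-1)\<close> opens a large entry and the step at time
    \<open>p (d (k-1))\<close> a small one; both times lie where \<open>same\<close> and
    \<open>flat\<close> force level steps of one kind.\<close>
  have "u (k-1) < t'" "p (d (k-1)) < t'" by (simp_all add: t'_def)
  then show False
    using same[of "u (k-1)"] same[of "p (d (k-1))"] flat[of "p (d (k-1))"] upper lower wt pt
    by simp
qed

text \<open>The times \<open>s\<close> and \<open>s'\<close> separate the entries: all of
  \<open>X\<close> but at most the last have positions below \<open>s\<close>, all but at most the
  first have values from \<open>s'\<close> on, and dually for \<open>Y\<close>. So each inequality
  in \<open>polygon\<close> passes through \<open>s\<close> or \<open>s'\<close>. It is used with
  \<open>s' = s\<close> above the height bound and with \<open>s' = s + 2\<close> for a forbidden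
  pair of steps.\<close>

lemma polygon_of_sets:
  assumes k: "k \<ge> 3"
    and X: "X \<subseteq> {i. i < n \<and> i \<le> p i}" "card X = k" "\<And>x. x \<in> X \<Longrightarrow> x < s' \<and> s \<le> p x"
      "card {x \<in> X. s \<le> x} \<le> 1" "card {x \<in> X. p x < s'} \<le> 1"
    and Y: "Y \<subseteq> {i. i < n \<and> p i < i}" "card Y = k" "\<And>y. y \<in> Y \<Longrightarrow> s \<le> y \<and> p y < s'"
      "card {y \<in> Y. y < s'} \<le> 1" "card {y \<in> Y. s \<le> p y} \<le> 1"
  shows "\<exists>u d. polygon k n p u d"
proof -
  have fin: "finite X" "finite Y" using X(1) Y(1) by (auto intro: finite_subset)
  obtain u where u: "bij_betw u {..<k} X" "strict_mono_on {..<k} u"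
    using ex_bij_betw_strict_mono_card[OF fin(1)] X(2) by metis
  obtain d where d: "bij_betw d {..<k} Y" "strict_mono_on {..<k} d"
    using ex_bij_betw_strict_mono_card[OF fin(2)] Y(2) by metis
  have uX: "u j \<in> X" and dY: "d j \<in> Y" if "j < k" for j
    using bij_betwE[OF u(1)] bij_betwE[OF d(1)] that by auto
  have mono: "u a < u b" "d a < d b" if "a < b" "b < k" for a b
    using u(2) d(2) that by (auto simp: strict_mono_on_def)
  have pmono: "p (u a) < p (u b)" "p (d a) < p (d b)" if "a < b" "b < k" for a b
    using upper_mono[of "u a" "u b"] lower_mono[of "d a" "d b"] mono[OF that] X(1) Y(1)
      uX[of a] uX[of b] dY[of a] dY[of b] that by auto
  have one: "a = b" if "card {x \<in> Z. P x} \<le> 1" "finite Z" "a \<in> Z" "b \<in> Z" "P a" "P b" for Z P and a b :: nat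
    using that card_le_Suc0_iff_eq[of "{x \<in> Z. P x}"] by auto
  have k': "0 < k" "1 < k" "k-2 < k" "k-1 < k" "k-2 < k-1" using k by auto
  have "u (k-2) < s"
    using one[OF X(4) fin(1) uX uX, of "k-2" "k-1"] mono(1)[of "k-2" "k-1"] k' by force
  moreover have "p (u 1) \<ge> s'"
    using one[OF X(5) fin(1) uX uX, of 0 1] pmono(1)[of 0 1] mono(1)[of 0 1] k' by force
  moreover have "d 1 \<ge> s'"
    using one[OF Y(4) fin(2) dY dY, of 0 1] mono(2)[of 0 1] k' by force
  moreover have "p (d (k-2)) < s"
    using one[OF Y(5) fin(2) dY dY, of "k-2" "k-1"] pmono(2)[of "k-2" "k-1"] mono(2)[of "k-2" "k-1"] k' by force
  moreover have "u (k-1) < s'" "s \<le> p (u 0)" "s \<le> d 0" "p (d (k-1)) < s'"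
    using X(3) Y(3) uX dY k' by blast+
  ultimately have "u (k-2) < d 0" "u (k-1) < d 1" "p (d (k-2)) < p (u 0)" "p (d (k-1)) < p (u 1)"
    by linarith+
  moreover have "u ` {..<k} \<subseteq> {..<n}" "d ` {..<k} \<subseteq> {..<n}"
    using uX dY X(1) Y(1) by auto
  ultimately have "polygon k n p u d"
    using mono pmono by (auto simp: polygon_def strict_mono_on_def)
  then show ?thesis by blast
qed

lemma not_low_heights_imp_polygon:
  assumes k: "k \<ge> 3" and "\<not> low_heights (k-1) n p"
  shows "\<exists>u d. polygon k n p u d"
proof -
  have finU: "finite {i. i < t \<and> P i}" for t :: nat and P by simp
  have finL: "finite {i. P i \<and> p i < t}" for t P
    by (rule finite_subset[OF _ finite_preimage_less[of t]]) auto
  have low_n: "i < n" if "p i < t" "t \<le> n" for i t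
    using that less_iff[of i] by linarith
  consider t where "t \<le> n" "height p t \<ge> k"
    | t where "t + 2 \<le> n" "height p t = k-1" "height p (t+2) = k-1" "(t \<le> p t) \<noteq> (t+1 \<le> p (t+1))"
    using assms unfolding low_heights_def by force
  then show ?thesis
  proof cases
    case 1
    obtain X where X: "X \<subseteq> {i. i < t \<and> t \<le> p i}" "card X = k"
      using 1(2) unfolding height_def by (meson obtain_subset_with_card_n)
    obtain Y where Y: "Y \<subseteq> {i. t \<le> i \<and> p i < t}" "card Y = k"
      using 1(2) unfolding height_eq_card_lower by (meson obtain_subset_with_card_n)
    have e: "{x \<in> X. t \<le> x} = {}" "{x \<in> X. p x < t} = {}" "{y \<in> Y. y < t} = {}" "{y \<in> Y. t \<le> p y} = {}"
      using X Y by auto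
    show ?thesis
      by (rule polygon_of_sets[OF k, of X t t Y]) (use X Y 1 low_n in \<open>auto simp: e\<close>)
  next
    case 2
    define A where "A = {i. t \<le> i \<and> i < t+2 \<and> i \<le> p i}"
    define B where "B = {i. t \<le> i \<and> i < t+2 \<and> p i < i}"
    have "A = {t} \<and> B = {t+1} \<or> A = {t+1} \<and> B = {t}"
    proof (cases "t \<le> p t")
      case True
      then have "p (t+1) < t+1" using 2 by simp
      then have "A = {t}" "B = {t+1}" using True
        by (auto simp: A_def B_def less_Suc_eq numeral_2_eq_2)
      then show ?thesis by simp
    next
      case False
      then have "t+1 \<le> p (t+1)" using 2 by simp
      then have "A = {t+1}" "B = {t}" using False
        by (auto simp: A_def B_def less_Suc_eq numeral_2_eq_2)
      then show ?thesis by simp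
    qed
    then have AB: "card A = 1" "card B = 1" by auto
    \<comment> \<open>To the \<open>k-1\<close> large entries open at \<open>t\<close>,
      \<open>X\<close> adds the large one at position \<open>t\<close> or \<open>t+1\<close>; to the
      \<open>k-1\<close> small entries open at \<open>t+2\<close>, \<open>Y\<close> adds the small
      one at the other of these positions. Both sets thus have size \<open>k\<close>.\<close>
    define X where "X = {i. i < t+2 \<and> i \<le> p i \<and> t \<le> p i}"
    define Y where "Y = {i. t \<le> i \<and> p i < i \<and> p i < t+2}"
    have fin: "finite X" "finite Y" unfolding X_def Y_def
      using finU finite_subset[OF _ finite_preimage_less[of "t+2"], of Y] by (auto simp: Y_def)
    have "X = {i. i < t \<and> t \<le> p i} \<union> A" by (auto simp: X_def A_def)
    moreover have "{i. i < t \<and> t \<le> p i} \<inter> A = {}" by (auto simp: A_def)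
    ultimately have cX: "card X = k"
      using 2 k AB fin by (auto simp: card_Un_disjoint height_def)
    have "Y = {i. t+2 \<le> i \<and> p i < t+2} \<union> B" by (auto simp: Y_def B_def)
    moreover have "{i. t+2 \<le> i \<and> p i < t+2} \<inter> B = {}" by (auto simp: B_def)
    ultimately have cY: "card Y = k"
      using 2 k AB fin by (auto simp: card_Un_disjoint height_eq_card_lower)
    show ?thesis
    proof (rule polygon_of_sets[OF k, of X "t+2" t Y])
      have "{x \<in> X. t \<le> x} = A" by (auto simp: X_def A_def)
      then show "card {x \<in> X. t \<le> x} \<le> 1" using AB by simp
      have "{y \<in> Y. y < t+2} = B" by (auto simp: Y_def B_def)
      then show "card {y \<in> Y. y < t+2} \<le> 1" using AB by simp
      have "{x \<in> X. p x < t+2} = X - {i. i < t+2 \<and> t+2 \<le> p i}" by (auto simp: X_def)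
      moreover have "card (X - {i. i < t+2 \<and> t+2 \<le> p i}) = card X - height p (t+2)"
        unfolding height_def using finU by (intro card_Diff_subset) (auto simp: X_def)
      ultimately show "card {x \<in> X. p x < t+2} \<le> 1" using cX 2 k by simp
      have "{y \<in> Y. t \<le> p y} = Y - {i. t \<le> i \<and> p i < t}" by (auto simp: Y_def)
      moreover have "card (Y - {i. t \<le> i \<and> p i < t}) = card Y - height p t"
        unfolding height_eq_card_lower using finL by (intro card_Diff_subset) (auto simp: Y_def)
      ultimately show "card {y \<in> Y. t \<le> p y} \<le> 1" using cY 2 k by simp
    qed (use cX cY 2(1) low_n[of _ "t+2"] in \<open>auto simp: X_def Y_def\<close>)
  qed
qed

lemma polygon_iff:
  assumes "k \<ge> 3"
  shows "(\<exists>u d. polygon k n p u d) \<longleftrightarrow> \<not> low_heights (k-1) n p"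
  using polygon_imp_not_low_heights[OF assms] not_low_heights_imp_polygon[OF assms] by metis

end

section \<open>Encoding by words\<close>

definition word_height :: "(bool \<times> bool) list \<Rightarrow> nat \<Rightarrow> int" where
  "word_height w t = (\<Sum>i<t. of_bool (fst (w ! i)) - of_bool (snd (w ! i)))"

text \<open>The start height \<open>h\<close> is a parameter for the recursion on the first letter.
  The first clause holds for permutations because a small entry at position \<open>t\<close> is
  itself open at time \<open>t\<close>; it forbids down steps at height 0 and hence negative
  heights.\<close>

definition valid :: "int \<Rightarrow> int \<Rightarrow> (bool \<times> bool) list \<Rightarrow> bool" where
  "valid m h w \<longleftrightarrow>
     (\<forall>t<length w. h + word_height w t = 0 \<longrightarrow> fst (w ! t)) \<and>
     h + word_height w (length w) = 0 \<and>
     (\<forall>t\<le>length w. h + word_height w t \<le> m) \<and>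
     (\<forall>t. t + 2 \<le> length w \<longrightarrow> h + word_height w t = m \<longrightarrow> h + word_height w (t + 2) = m \<longrightarrow>
        (fst (w ! t) \<longleftrightarrow> fst (w ! (t + 1))))"

text \<open>Letter \<open>i\<close> tells whether \<open>i\<close> is the position, and whether it is the value, of a weak excedance.\<close>

definition word :: "nat \<Rightarrow> (nat \<Rightarrow> nat) \<Rightarrow> (bool \<times> bool) list" where
  "word n p = map (\<lambda>i. (i \<le> p i, inv p i \<le> i)) [0..<n]"

lemma length_word [simp]: "length (word n p) = n"
  by (simp add: word_def)

lemma nth_word [simp]: "i < n \<Longrightarrow> word n p ! i = (i \<le> p i, inv p i \<le> i)"
  by (simp add: word_def)

lemma word_height_0 [simp]: "word_height w 0 = 0"
  by (simp add: word_height_def)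

lemma word_height_Suc:
  "word_height w (Suc t) = word_height w t + of_bool (fst (w ! t)) - of_bool (snd (w ! t))"
  by (simp add: word_height_def)

lemma (in finite_perm) word_height_word: "t \<le> n \<Longrightarrow> word_height (word n p) t = int (height p t)"
proof (induction t)
  case 0
  then show ?case by (simp add: height_def)
next
  case (Suc t)
  then show ?case using height_Suc[of t]
    by (cases "inv p t \<le> t"; cases "t \<le> p t") (simp_all add: word_height_Suc)
qed

lemma (in finite_perm) valid_word_iff: "valid (int m) 0 (word n p) \<longleftrightarrow> low_heights m n p"
proof -
  have pos: "t \<le> p t" if "t < n" "height p t = 0" for t
  proof (rule ccontr)
    assume "\<not> t \<le> p t"
    then have "card {t} \<le> height p t" by (intro height_ge_lower[of _ "\<lambda>i. i"]) auto
    then show False using that by simp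
  qed
  have "height p n = 0" using height_beyond[of n] by simp
  then show ?thesis
    unfolding valid_def low_heights_def
    by (auto simp: word_height_word pos)
qed

section \<open>321-avoiding permutations and valid words\<close>

lemma strict_mono_on_image_unique:
  fixes p q :: "nat \<Rightarrow> nat"
  assumes "strict_mono_on A p" "strict_mono_on A q" "p ` A = q ` A" "x \<in> A"
  shows "p x = q x"
  using assms(4)
proof (induction x rule: less_induct)
  case (less x)
  have step: "\<not> p x < q x"
    if pq: "strict_mono_on A p" "strict_mono_on A q" "p ` A = q ` A" "\<And>y. y < x \<Longrightarrow> y \<in> A \<Longrightarrow> p y = q y"
    for p q :: "nat \<Rightarrow> nat"
  proof
    assume lt: "p x < q x"
    obtain y where y: "y \<in> A" "p x = q y" using pq(3) less.prems by blast
    then have "y < x" using lt strict_mono_on_less[OF pq(2) y(1) less.prems] by simp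
    then have "p y < p x" using strict_mono_onD[OF pq(1) y(1) less.prems] by simp
    then show False using pq(4)[OF \<open>y < x\<close> y(1)] y(2) by simp
  qed
  show ?case
    using step[of p q] step[of q p] assms less.IH by (metis linorder_neqE_nat)
qed

lemma (in perm_321_avoiding) strict_mono_upper: "strict_mono_on {i. i < n \<and> i \<le> p i} p"
  by (rule strict_mono_onI) (use upper_mono in blast)

lemma (in perm_321_avoiding) strict_mono_lower: "strict_mono_on {i. i < n \<and> \<not> i \<le> p i} p"
  by (rule strict_mono_onI) (use lower_mono not_le in blast)

lemma word_inj:
  assumes p: "perm_321_avoiding n p" and q: "perm_321_avoiding n q" and eq: "word n p = word n q"
  shows "p = q"
proof
  interpret p: perm_321_avoiding n p by fact
  interpret q: perm_321_avoiding n q by fact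
  have U: "i \<le> p i \<longleftrightarrow> i \<le> q i" and V: "inv p i \<le> i \<longleftrightarrow> inv q i \<le> i" if "i < n" for i
    using arg_cong[OF eq, of "\<lambda>w. w ! i"] that by simp_all
  \<comment> \<open>\<open>P\<close> will be the identity for the large entries and
    \<open>Not\<close> for the small ones, so that both are treated at once.\<close>
  have img: "r ` {i. i < n \<and> P (i \<le> r i)} = {v. v < n \<and> P (inv r v \<le> v)}"
    if "finite_perm n r" for r and P :: "bool \<Rightarrow> bool"
  proof -
    interpret r: finite_perm n r by fact
    show ?thesis
    proof (intro set_eqI iffI)
      fix v assume "v \<in> {v. v < n \<and> P (inv r v \<le> v)}"
      then show "v \<in> r ` {i. i < n \<and> P (i \<le> r i)}"
        using r.less_iff[of "inv r v"] by (intro image_eqI[of _ _ "inv r v"]) auto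
    qed auto
  qed
  fix x
  have eqA: "{i. i < n \<and> i \<le> q i} = {i. i < n \<and> i \<le> p i}"
    "{i. i < n \<and> \<not> i \<le> q i} = {i. i < n \<and> \<not> i \<le> p i}"
    using U by auto
  note sm = p.strict_mono_upper q.strict_mono_upper[unfolded eqA]
    p.strict_mono_lower q.strict_mono_lower[unfolded eqA]
  have "{v. v < n \<and> P (inv p v \<le> v)} = {v. v < n \<and> P (inv q v \<le> v)}"
    "{i. i < n \<and> P (i \<le> p i)} = {i. i < n \<and> P (i \<le> q i)}" for P :: "bool \<Rightarrow> bool"
    using U V by auto
  then have im: "p ` {i. i < n \<and> P (i \<le> p i)} = q ` {i. i < n \<and> P (i \<le> p i)}" for P :: "bool \<Rightarrow> bool"
    using img[OF p.finite_perm_axioms, of P] img[OF q.finite_perm_axioms, of P] by simp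
  show "p x = q x"
  proof (cases "x < n")
    case True
    show ?thesis
    proof (cases "x \<le> p x")
      case True
      then show ?thesis
        using strict_mono_on_image_unique[OF sm(1,2) im[of "\<lambda>b. b"], of x] \<open>x < n\<close> by simp
    next
      case False
      then show ?thesis
        using strict_mono_on_image_unique[OF sm(3,4) im[of Not], of x] \<open>x < n\<close> by simp
    qed
  next
    case False
    then show ?thesis using permutes_not_in[OF p.perm, of x] permutes_not_in[OF q.perm, of x] by simp
  qed
qed

lemma ex_strict_mono_bij:
  fixes A V :: "nat set"
  assumes "finite A" "finite V" "card A = card V"
  obtains g where "bij_betw g A V" "strict_mono_on A g"
proof -
  obtain a where a: "bij_betw a {..<card A} A" "strict_mono_on {..<card A} a"
    using ex_bij_betw_strict_mono_card[OF assms(1)] by metis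
  obtain v where v: "bij_betw v {..<card A} V" "strict_mono_on {..<card A} v"
    using ex_bij_betw_strict_mono_card[OF assms(2)] assms(3) by metis
  define b where "b = the_inv_into {..<card A} a"
  have b: "bij_betw b A {..<card A}" unfolding b_def by (rule bij_betw_the_inv_into[OF a(1)])
  have ab: "a (b i) = i" if "i \<in> A" for i
    unfolding b_def using f_the_inv_into_f_bij_betw[OF a(1), of i] that by simp
  have bA: "b i \<in> {..<card A}" if "i \<in> A" for i using bij_betwE[OF b] that by blast
  have "strict_mono_on A (v \<circ> b)"
  proof (rule strict_mono_onI)
    fix i j assume ij: "i \<in> A" "j \<in> A" "i < j"
    then have "b i < b j" using strict_mono_on_less[OF a(2) bA bA, of i j] by (simp add: ab)
    then show "(v \<circ> b) i < (v \<circ> b) j" using strict_mono_onD[OF v(2) bA bA, of i j] ij by simp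
  qed
  moreover have "bij_betw (v \<circ> b) A V" using bij_betw_trans[OF b v(1)] .
  ultimately show ?thesis using that by blast
qed

lemma card_less_strict_mono_image:
  fixes g :: "nat \<Rightarrow> nat"
  assumes "bij_betw g A V" "strict_mono_on A g" "i \<in> A"
  shows "card {v \<in> V. v < g i} = card {j \<in> A. j < i}"
proof -
  have "{v \<in> V. v < g i} = g ` {j \<in> A. j < i}"
    using assms strict_mono_on_less[OF assms(2)] by (auto simp: bij_betw_def)
  moreover have "inj_on g {j \<in> A. j < i}"
    using assms(1) by (auto simp: bij_betw_def intro: inj_on_subset)
  ultimately show ?thesis by (simp add: card_image)
qed

lemma word_height_eq_card:
  "word_height w t = int (card {i. i < t \<and> fst (w ! i)}) - int (card {i. i < t \<and> snd (w ! i)})"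
proof (induction t)
  case (Suc t)
  show ?case by (simp add: word_height_Suc Suc card_Collect_less_Suc del: of_bool_eq(1,2))
qed simp

lemma valid_nonneg:
  assumes "valid m h w" "0 \<le> h" "t \<le> length w"
  shows "0 \<le> h + word_height w t"
  using assms(3)
proof (induction t)
  case (Suc t)
  then have "h + word_height w t = 0 \<longrightarrow> fst (w ! t)" "0 \<le> h + word_height w t"
    using assms(1) by (auto simp: valid_def)
  then show ?case by (auto simp: word_height_Suc of_bool_def)
qed (use assms in simp)

text \<open>Positions and values are matched in increasing order, \<open>A\<close> with
  \<open>V\<close> and the complements \<open>B\<close> with \<open>Y\<close>. An \<open>i\<close>
  in \<open>A\<close> with \<open>g i < i\<close> would make the height at \<open>i\<close>
  negative. An \<open>i\<close> in \<open>B\<close> with \<open>i \<le> h i\<close> would make it 0,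
  where the letter must mark a large position.\<close>

lemma word_surj:
  assumes w: "valid m 0 w" "length w = n"
  shows "\<exists>p. perm_321_avoiding n p \<and> word n p = w"
proof -
  define A where "A = {i. i < n \<and> fst (w ! i)}"
  define V where "V = {i. i < n \<and> snd (w ! i)}"
  define B where "B = {..<n} - A"
  define Y where "Y = {..<n} - V"
  have fin: "finite A" "finite V" "finite B" "finite Y" by (auto simp: A_def V_def B_def Y_def)
  have "word_height w n = 0" using w by (simp add: valid_def)
  then have cAV: "card A = card V" by (simp add: word_height_eq_card A_def V_def)
  have sub: "A \<subseteq> {..<n}" "V \<subseteq> {..<n}" by (auto simp: A_def V_def)
  then have cBY: "card B = card Y" by (simp add: B_def Y_def card_Diff_subset fin cAV)
  obtain g where g: "bij_betw g A V" "strict_mono_on A g"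
    using ex_strict_mono_bij[OF fin(1,2) cAV] .
  obtain h where h: "bij_betw h B Y" "strict_mono_on B h"
    using ex_strict_mono_bij[OF fin(3,4) cBY] .
  have wh: "word_height w t = int (card {i \<in> A. i < t}) - int (card {i \<in> V. i < t})" if "t \<le> n" for t
  proof -
    have "{i \<in> A. i < t} = {i. i < t \<and> fst (w ! i)}" "{i \<in> V. i < t} = {i. i < t \<and> snd (w ! i)}"
      using that by (auto simp: A_def V_def)
    then show ?thesis by (simp add: word_height_eq_card)
  qed
  have wh': "word_height w t = int (card {i \<in> Y. i < t}) - int (card {i \<in> B. i < t})" if "t \<le> n" for t
  proof -
    have split: "card {i \<in> C. i < t} + card {i \<in> {..<n} - C. i < t} = t" if "finite C" "C \<subseteq> {..<n}" for C
    proof -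
      have "{i \<in> C. i < t} \<union> {i \<in> {..<n} - C. i < t} = {..<t}" using that \<open>t \<le> n\<close> by auto
      moreover have "card ({i \<in> C. i < t} \<union> {i \<in> {..<n} - C. i < t}) =
          card {i \<in> C. i < t} + card {i \<in> {..<n} - C. i < t}"
        using that by (intro card_Un_disjoint) auto
      ultimately show ?thesis by simp
    qed
    show ?thesis using split[OF fin(1) sub(1)] split[OF fin(2) sub(2)] wh[OF that]
      unfolding B_def Y_def by linarith
  qed
  have upper: "i \<le> g i" if i: "i \<in> A" for i
  proof (rule ccontr)
    assume "\<not> i \<le> g i"
    then have lt: "g i < i" by simp
    have gi: "g i \<in> V" using bij_betwE[OF g(1)] i by blast
    have "card (insert (g i) {v \<in> V. v < g i}) \<le> card {v \<in> V. v < i}"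
      using lt gi fin by (intro card_mono) auto
    then have "card {j \<in> A. j < i} < card {v \<in> V. v < i}"
      using fin card_less_strict_mono_image[OF g i] by simp
    moreover have "i \<le> n" using i by (simp add: A_def)
    ultimately show False using valid_nonneg[OF w(1), of i] wh[of i] w(2) by simp
  qed
  have lower: "h i < i" if i: "i \<in> B" for i
  proof (rule ccontr)
    assume "\<not> h i < i"
    then have "card {v \<in> Y. v < i} \<le> card {v \<in> Y. v < h i}"
      using fin by (intro card_mono) auto
    then have "card {v \<in> Y. v < i} \<le> card {j \<in> B. j < i}"
      by (simp add: card_less_strict_mono_image[OF h i])
    moreover have "i < n" using i by (simp add: B_def)
    ultimately have "word_height w i = 0"
      using valid_nonneg[OF w(1), of i] wh'[of i] w(2) by simp
    then have "fst (w ! i)" using w \<open>i < n\<close> by (simp add: valid_def)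
    then show False using i by (simp add: A_def B_def)
  qed
  define p where "p = (\<lambda>i. if i \<in> A then g i else if i < n then h i else i)"
  have pA: "p i = g i" if "i \<in> A" for i using that by (simp add: p_def)
  have pB: "p i = h i" if "i \<in> B" for i using that by (simp add: p_def B_def)
  have AB: "i < n \<longleftrightarrow> i \<in> A \<or> i \<in> B" for i using sub by (auto simp: B_def)
  have "bij_betw p A V" using g(1) by (simp add: pA cong: bij_betw_cong)
  moreover have "bij_betw p B Y" using h(1) by (simp add: pB cong: bij_betw_cong)
  moreover have "V \<inter> Y = {}" by (auto simp: Y_def)
  ultimately have "bij_betw p (A \<union> B) (V \<union> Y)" by (rule bij_betw_combine)
  moreover have "A \<union> B = {..<n}" "V \<union> Y = {..<n}" using sub by (auto simp: B_def Y_def)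
  ultimately have perm: "p permutes {..<n}"
    using sub by (intro bij_imp_permutes) (auto simp: p_def)
  interpret finite_perm n p by unfold_locales fact
  have U: "i \<le> p i \<longleftrightarrow> i \<in> A" if "i < n" for i
  proof (cases "i \<in> A")
    case True
    then show ?thesis using upper pA by simp
  next
    case False
    then have "i \<in> B" using AB[of i] that by simp
    then show ?thesis using lower[of i] pB False by simp
  qed
  have P321: "perm_321_avoiding n p"
  proof
    fix i j assume ij: "i < j" "j < n"
    show "p i < p j" if "i \<le> p i" "j \<le> p j"
    proof -
      have "i \<in> A" "j \<in> A" using that ij U by simp_all
      then show ?thesis using strict_mono_onD[OF g(2) _ _ ij(1)] by (simp add: pA)
    qed
    show "p i < p j" if "p i < i" "p j < j"
    proof -
      have "i \<notin> A" "j \<notin> A" using that ij U[of i] U[of j] by simp_all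
      then have "i \<in> B" "j \<in> B" using ij AB by (metis less_trans)+
      then show ?thesis using strict_mono_onD[OF h(2) _ _ ij(1)] by (simp add: pB)
    qed
  qed
  have "word n p = w"
  proof (rule nth_equalityI)
    fix v assume "v < length (word n p)"
    then have v: "v < n" by simp
    have "inv p v \<le> v \<longleftrightarrow> v \<in> V"
    proof -
      define i where "i = inv p v"
      have i: "p i = v" "i < n" using v less_iff[of i] by (simp_all add: i_def)
      show ?thesis unfolding i_def[symmetric]
      proof (cases "i \<in> A")
        case True
        then have "v \<in> V" using bij_betwE[OF g(1)] pA i(1) by metis
        then show "i \<le> v \<longleftrightarrow> v \<in> V" using U[OF i(2)] True i(1) by simp
      next
        case False
        then have "i \<in> B" using AB i(2) by simp
        then have "v \<in> Y" using bij_betwE[OF h(1)] pB i(1) by metis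
        then show "i \<le> v \<longleftrightarrow> v \<in> V" using U[OF i(2)] False i(1) by (simp add: Y_def)
      qed
    qed
    then show "word n p ! v = w ! v" using v U[OF v] by (simp add: A_def V_def prod_eq_iff del: One_nat_def)
  qed (use w in simp)
  then show ?thesis using P321 by blast
qed

section \<open>Transfer of the count to valid words\<close>

lemma one_line_permutes:
  assumes "p permutes {..<n}"
  shows "one_line n p \<in> permutations_of_set {1..n}"
proof -
  have "set (one_line n p) = Suc ` p ` {..<n}" by (auto simp: one_line_def)
  also have "\<dots> = {1..n}" using permutes_image[OF assms] by (simp add: image_Suc_lessThan)
  finally show ?thesis
    using permutes_inj[OF assms]
    by (auto simp: permutations_of_set_def one_line_def distinct_map inj_on_def dest: injD)
qed

lemma ex_one_line:
  assumes "\<alpha> \<in> permutations_of_set {1..n}"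
  shows "\<exists>p. p permutes {..<n} \<and> one_line n p = \<alpha>"
proof -
  have \<alpha>: "distinct \<alpha>" "set \<alpha> = {1..n}" "length \<alpha> = n"
    using assms distinct_card[of \<alpha>] by (auto simp: permutations_of_set_def)
  have rng: "\<alpha> ! i \<in> {1..n}" if "i < n" for i using nth_mem[of i \<alpha>] that \<alpha> by simp
  define p where "p = (\<lambda>i. if i < n then \<alpha> ! i - 1 else i)"
  have sub: "p ` {..<n} \<subseteq> {..<n}"
  proof
    fix v assume "v \<in> p ` {..<n}"
    then obtain i where "i < n" "v = \<alpha> ! i - 1" by (auto simp: p_def)
    then show "v \<in> {..<n}" using rng[of i] by auto
  qed
  have inj: "inj_on p {..<n}"
  proof (rule inj_onI)
    fix i j assume ij: "i \<in> {..<n}" "j \<in> {..<n}" "p i = p j"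
    then have "\<alpha> ! i = \<alpha> ! j" using rng[of i] rng[of j] by (auto simp: p_def)
    then show "i = j" using ij \<alpha> nth_eq_iff_index_eq[of \<alpha> i j] by simp
  qed
  then have "bij_betw p {..<n} {..<n}" using endo_inj_surj[OF _ sub] by (simp add: bij_betw_def)
  then have "p permutes {..<n}" by (rule bij_imp_permutes) (simp add: p_def)
  moreover have "one_line n p = \<alpha>"
  proof (rule nth_equalityI)
    fix i assume "i < length (one_line n p)"
    then show "one_line n p ! i = \<alpha> ! i" using rng[of i] by (simp add: p_def)
  qed (simp add: \<alpha>)
  ultimately show ?thesis by blast
qed

lemma one_line_inj:
  assumes "p permutes {..<n}" "q permutes {..<n}" "one_line n p = one_line n q"
  shows "p = q"
proof
  fix i
  show "p i = q i"
  proof (cases "i < n")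
    case True
    then show ?thesis using arg_cong[OF assms(3), of "\<lambda>\<alpha>. \<alpha> ! i"] by simp
  next
    case False
    then show ?thesis using permutes_not_in[OF assms(1)] permutes_not_in[OF assms(2)] by simp
  qed
qed

text \<open>On \<open>S\<close>, both \<open>one_line n\<close> and \<open>word n\<close> are
  bijections, onto the permutations counted by \<open>f\<close> and onto the valid words.\<close>

lemma f_eq_card_valid:
  assumes "k \<ge> 3"
  shows "f k n = card {w. length w = n \<and> valid (int (k-1)) 0 w}"
proof -
  define S where "S = {p. perm_321_avoiding n p \<and> low_heights (k-1) n p}"
  have perm: "p permutes {..<n}" if "p \<in> S" for p
    using that by (auto simp: S_def perm_321_avoiding_def finite_perm_def)
  have iff: "avoids (one_line n p) [3,2,1] \<and> k_gon_avoiding k (one_line n p) \<longleftrightarrow> p \<in> S"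
    if p: "p permutes {..<n}" for p
  proof -
    have "avoids (one_line n p) [3,2,1] \<longleftrightarrow> perm_321_avoiding n p"
      by (simp only: avoids_def contains_321_iff perm_321_avoiding_iff[OF p])
    moreover have "k_gon_avoiding k (one_line n p) \<longleftrightarrow> low_heights (k-1) n p"
      if "perm_321_avoiding n p"
      using k_gon_avoiding_iff[OF assms, of p n] permutes_inj_on[OF p]
        perm_321_avoiding.polygon_iff[OF that assms] by simp
    ultimately show ?thesis by (auto simp: S_def)
  qed
  have "bij_betw (one_line n) S {\<alpha> \<in> permutations_of_set {1..n}. avoids \<alpha> [3,2,1] \<and> k_gon_avoiding k \<alpha>}"
    unfolding bij_betw_def
  proof
    show "inj_on (one_line n) S" using one_line_inj perm by (auto simp: inj_on_def)
    show "one_line n ` S = {\<alpha> \<in> permutations_of_set {1..n}. avoids \<alpha> [3,2,1] \<and> k_gon_avoiding k \<alpha>}"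
    proof (intro equalityI subsetI)
      fix \<alpha> assume "\<alpha> \<in> one_line n ` S"
      then show "\<alpha> \<in> {\<alpha> \<in> permutations_of_set {1..n}. avoids \<alpha> [3,2,1] \<and> k_gon_avoiding k \<alpha>}"
        using one_line_permutes perm iff by blast
    next
      fix \<alpha> assume "\<alpha> \<in> {\<alpha> \<in> permutations_of_set {1..n}. avoids \<alpha> [3,2,1] \<and> k_gon_avoiding k \<alpha>}"
      then show "\<alpha> \<in> one_line n ` S" using ex_one_line[of \<alpha> n] iff by blast
    qed
  qed
  then have "f k n = card S" unfolding f_def by (simp add: bij_betw_same_card)
  moreover have "bij_betw (word n) S {w. length w = n \<and> valid (int (k-1)) 0 w}"
    unfolding bij_betw_def
  proof
    show "inj_on (word n) S" using word_inj by (auto simp: inj_on_def S_def)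
    have v: "valid (int (k-1)) 0 (word n p) \<longleftrightarrow> low_heights (k-1) n p" if "perm_321_avoiding n p" for p
      using that by (intro finite_perm.valid_word_iff) (simp add: perm_321_avoiding_def)
    show "word n ` S = {w. length w = n \<and> valid (int (k-1)) 0 w}"
    proof (intro equalityI subsetI)
      fix w assume "w \<in> word n ` S"
      then show "w \<in> {w. length w = n \<and> valid (int (k-1)) 0 w}" using v by (auto simp: S_def)
    next
      fix w assume w: "w \<in> {w. length w = n \<and> valid (int (k-1)) 0 w}"
      then obtain p where "perm_321_avoiding n p" "word n p = w" using word_surj by blast
      then show "w \<in> word n ` S" using v w by (auto simp: S_def)
    qed
  qed
  ultimately show ?thesis by (simp add: bij_betw_same_card)
qed

section \<open>Generating functions\<close>

unbundle fps_syntax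

definition word_gf :: "((bool \<times> bool) list \<Rightarrow> bool) \<Rightarrow> int fps" where
  "word_gf P = Abs_fps (\<lambda>n. int (card {w. length w = n \<and> P w}))"

lemma word_gf_False [simp]: "word_gf (\<lambda>w. False) = 0"
  by (rule fps_ext) (simp add: word_gf_def)

text \<open>Words are split by their first letter. With an arbitrary predicate the rule applies
  again to words with a prescribed first letter, as the top height requires.\<close>

lemma word_gf_unfold:
  "word_gf P = of_bool (P []) + fps_X *
     (word_gf (\<lambda>w. P ((True, True) # w)) + word_gf (\<lambda>w. P ((True, False) # w)) +
      word_gf (\<lambda>w. P ((False, True) # w)) + word_gf (\<lambda>w. P ((False, False) # w)))"
proof (rule fps_ext)
  fix n
  show "word_gf P $ n = (of_bool (P []) + fps_X *
     (word_gf (\<lambda>w. P ((True, True) # w)) + word_gf (\<lambda>w. P ((True, False) # w)) +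
      word_gf (\<lambda>w. P ((False, True) # w)) + word_gf (\<lambda>w. P ((False, False) # w)))) $ n"
  proof (cases n)
    case 0
    have "{w. length w = 0 \<and> P w} = (if P [] then {[]} else {})" by auto
    then show ?thesis by (simp add: 0 word_gf_def)
  next
    case (Suc m)
    have fin: "finite {w :: (bool \<times> bool) list. length w = m \<and> Q w}" for Q
      by (rule finite_subset[OF _ finite_lists_length_eq[of UNIV m]]) auto
    define S where "S = (\<lambda>x. (#) x ` {w. length w = m \<and> P (x # w)})"
    have finS: "finite (S x)" and cS: "card (S x) = card {w. length w = m \<and> P (x # w)}" for x
      using fin by (auto simp: S_def card_image)
    have "{w. length w = Suc m \<and> P w} = (\<Union>x\<in>UNIV. S x)"
      by (auto simp: S_def length_Suc_conv image_iff)
    also have "card \<dots> = (\<Sum>x\<in>UNIV. card (S x))"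
      using finS by (intro card_UN_disjoint) (auto simp: S_def)
    also have "\<dots> = card (S (True, True)) + card (S (True, False)) + card (S (False, True)) + card (S (False, False))"
      by (simp add: UNIV_Times_UNIV[symmetric] UNIV_bool insert_Times_insert del: UNIV_Times_UNIV)
    finally show ?thesis by (simp add: Suc word_gf_def cS)
  qed
qed

lemma valid_Nil [simp]: "valid m h [] \<longleftrightarrow> h = 0 \<and> h \<le> m"
  by (auto simp: valid_def)

lemma word_height_Cons_Suc [simp]:
  "word_height (x # w) (Suc t) = of_bool (fst x) - of_bool (snd x) + word_height w t"
  unfolding word_height_def by (subst sum.lessThan_Suc_shift) simp

lemma all_le_Suc_iff: "(\<forall>t\<le>Suc n. P t) \<longleftrightarrow> P 0 \<and> (\<forall>t\<le>n. P (Suc t))"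
  by (metis Suc_le_mono le0 not0_implies_Suc)

lemma all_nat_iff: "(\<forall>t::nat. P t) \<longleftrightarrow> P 0 \<and> (\<forall>t. P (Suc t))"
  by (metis not0_implies_Suc)

text \<open>The tail starts at the shifted height; the last clause is the only pair condition that
  involves the removed letter.\<close>

lemma valid_Cons:
  "valid m h (x # w) \<longleftrightarrow> h \<le> m \<and> (h = 0 \<longrightarrow> fst x) \<and> valid m (h + of_bool (fst x) - of_bool (snd x)) w \<and>
     (w \<noteq> [] \<longrightarrow> h = m \<longrightarrow>
       of_bool (fst x) - of_bool (snd x) + (of_bool (fst (hd w)) - of_bool (snd (hd w))) = (0 :: int) \<longrightarrow>
       fst x = fst (hd w))"
proof -
  define d :: int where "d = of_bool (fst x) - of_bool (snd x)"
  have 2: "word_height (x # w) 2 = d + (of_bool (fst (w ! 0)) - of_bool (snd (w ! 0)))"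
    using word_height_Cons_Suc[of x w 1] word_height_Suc[of w 0] by (simp add: numeral_2_eq_2 d_def)
  have A: "(\<forall>t<length (x # w). h + word_height (x # w) t = 0 \<longrightarrow> fst ((x # w) ! t)) \<longleftrightarrow>
      (h = 0 \<longrightarrow> fst x) \<and> (\<forall>t<length w. h + d + word_height w t = 0 \<longrightarrow> fst (w ! t))"
    unfolding list.size(4) add_0_right add_Suc_right One_nat_def All_less_Suc2 by (simp add: d_def add.assoc)
  have B: "(\<forall>t\<le>length (x # w). h + word_height (x # w) t \<le> m) \<longleftrightarrow>
      h \<le> m \<and> (\<forall>t\<le>length w. h + d + word_height w t \<le> m)"
    unfolding list.size(4) add_0_right add_Suc_right One_nat_def all_le_Suc_iff by (simp add: d_def add.assoc)
  have C: "(\<forall>t. t + 2 \<le> length (x # w) \<longrightarrow> h + word_height (x # w) t = m \<longrightarrow>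
          h + word_height (x # w) (t + 2) = m \<longrightarrow> (fst ((x # w) ! t) \<longleftrightarrow> fst ((x # w) ! (t + 1)))) \<longleftrightarrow>
      (w \<noteq> [] \<longrightarrow> h = m \<longrightarrow> d + (of_bool (fst (hd w)) - of_bool (snd (hd w))) = 0 \<longrightarrow> fst x = fst (hd w)) \<and>
      (\<forall>t. t + 2 \<le> length w \<longrightarrow> h + d + word_height w t = m \<longrightarrow>
          h + d + word_height w (t + 2) = m \<longrightarrow> (fst (w ! t) \<longleftrightarrow> fst (w ! (t + 1))))"
    by (subst all_nat_iff, rule arg_cong2[of _ _ _ _ "(\<and>)"])
      (cases w; auto simp: 2 hd_conv_nth d_def add.assoc)+
  show ?thesis unfolding valid_def A B C by (auto simp: d_def add.assoc)
qed

lemma not_valid_above: "m < h \<Longrightarrow> \<not> valid m h w"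
  by (auto simp: valid_def dest: spec[of _ 0])

lemma word_gf_valid_0:
  assumes "0 < m"
  shows "word_gf (valid m 0) = 1 + fps_X * (word_gf (valid m 0) + word_gf (valid m 1))"
  using assms by (subst word_gf_unfold) (simp add: valid_Cons)

lemma word_gf_valid_middle:
  assumes "0 < h" "h < m"
  shows "word_gf (valid m h) =
    fps_X * (2 * word_gf (valid m h) + word_gf (valid m (h+1)) + word_gf (valid m (h-1)))"
  using assms by (subst word_gf_unfold) (simp add: valid_Cons algebra_simps)

text \<open>At the top height the first letter restricts the second: a level step may be followed by
  its own kind or by a down step, and a down step by anything but an up step. Hence the split by
  first letter into \<open>e\<close>, \<open>l\<close> and \<open>d\<close>.\<close>

lemma word_gf_valid_top:
  assumes "2 \<le> m"
  shows "(1 - fps_X) * word_gf (valid m m) =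
    fps_X^2 * (1 + fps_X) * (2 * word_gf (valid m (m-1)) + word_gf (valid m (m-2)))"
proof -
  define e where "e = word_gf (\<lambda>w. valid m m ((True, True) # w))"
  define l where "l = word_gf (\<lambda>w. valid m m ((False, False) # w))"
  define d where "d = word_gf (\<lambda>w. valid m m ((False, True) # w))"
  have ne: "m \<noteq> 0" "m - 1 \<noteq> 0" "m \<noteq> 1" using assms by auto
  note simps = valid_Cons ne not_valid_above
  have g: "word_gf (valid m m) = fps_X * (e + d + l)"
    by (subst word_gf_unfold) (simp add: simps e_def d_def l_def)
  have "e = fps_X * (e + d)"
    unfolding e_def d_def by (subst word_gf_unfold) (use assms in \<open>simp add: simps\<close>)
  moreover have "l = fps_X * (l + d)"
    unfolding l_def d_def by (subst word_gf_unfold) (use assms in \<open>simp add: simps\<close>)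
  moreover have d: "d = fps_X * (2 * word_gf (valid m (m-1)) + word_gf (valid m (m-2)))"
    unfolding d_def by (subst word_gf_unfold) (use assms in \<open>simp add: simps algebra_simps\<close>)
  ultimately have "(1 - fps_X) * e = fps_X * d" "(1 - fps_X) * l = fps_X * d"
    by (simp_all add: algebra_simps)
  then have "(1 - fps_X) * (e + d + l) = (1 + fps_X) * d"
    by (simp add: algebra_simps)
  then have "(1 - fps_X) * word_gf (valid m m) = fps_X * (1 + fps_X) * d"
    unfolding g by (simp add: mult.left_commute mult.assoc)
  then show ?thesis unfolding d by (simp add: power2_eq_square mult_ac)
qed

section \<open>Polynomial solution of the linear system\<close>

text \<open>With \<open>U\<close> the Chebyshev polynomials of the second kind, this is x^(s/2)
  U_s(1 / (2 sqrt x)). Truncated subtraction is harmless: for \<open>j > s\<close> the coefficient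
  is \<open>0 choose j\<close>, which is 0.\<close>

definition cheb :: "nat \<Rightarrow> int fps" where
  "cheb s = Abs_fps (\<lambda>j. (-1) ^ j * int ((s - j) choose j))"

lemma cheb_0 [simp]: "cheb 0 = 1"
  by (rule fps_ext) (simp add: cheb_def)

lemma cheb_1 [simp]: "cheb (Suc 0) = 1"
  by (rule fps_ext) (auto simp: cheb_def)

lemma cheb_rec: "cheb (Suc (Suc s)) = cheb (Suc s) - fps_X * cheb s"
proof (rule fps_ext)
  fix n
  show "cheb (Suc (Suc s)) $ n = (cheb (Suc s) - fps_X * cheb s) $ n"
  proof (cases n)
    case (Suc j)
    show ?thesis
    proof (cases "j \<le> s")
      case True
      then have "Suc s - j = Suc (s - j)" by simp
      then show ?thesis by (simp add: cheb_def Suc algebra_simps)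
    qed (simp add: cheb_def Suc)
  qed (simp add: cheb_def)
qed

text \<open>The equations of \<open>word_gf_valid_middle\<close> take this form once the series at
  height \<open>h\<close> is multiplied by \<open>fps_X ^ h\<close>; height \<open>h\<close>
  corresponds to \<open>cheb (2 * h)\<close>.\<close>

lemma cheb_even_rec:
  "cheb (2 * h + 4) = (1 - 2 * fps_X) * cheb (2 * h + 2) - fps_X^2 * cheb (2 * h)"
proof -
  have e1: "cheb (2*h+1) = cheb (2*h+2) + fps_X * cheb (2*h)"
    using cheb_rec[of "2*h"] by simp
  have e3: "cheb (2*h+3) = cheb (2*h+2) - fps_X * cheb (2*h+1)"
    using cheb_rec[of "2*h+1"] by (simp add: eval_nat_numeral)
  have e4: "cheb (2*h+4) = cheb (2*h+3) - fps_X * cheb (2*h+2)"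
    using cheb_rec[of "2*h+2"] by (simp add: eval_nat_numeral)
  show ?thesis unfolding e4 e3 e1 by (simp add: algebra_simps power2_eq_square)
qed

lemma L_eq_cheb:
  assumes "s \<le> n"
  shows "L k n s = (cheb s * Abs_fps (\<lambda>n. int (f k n))) $ n"
proof -
  have "(cheb s * Abs_fps (\<lambda>n. int (f k n))) $ n =
      (\<Sum>j=0..n. (-1) ^ j * int ((s - j) choose j) * int (f k (n - j)))"
    by (simp add: fps_mult_nth cheb_def)
  also have "\<dots> = L k n s"
    unfolding L_def using assms by (intro sum.mono_neutral_right) (auto simp: not_le)
  finally show ?thesis by simp
qed

text \<open>\<open>cheb_num h\<close> is \<open>cheb (2 * h - 1)\<close> for positive \<open>h\<close>; it is the inhomogeneous part of the solution
  of the linear system for the generating functions, and matters only through its degree.\<close>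

fun cheb_num :: "nat \<Rightarrow> int fps" where
  "cheb_num 0 = 0"
| "cheb_num (Suc 0) = 1"
| "cheb_num (Suc (Suc h)) = (1 - 2 * fps_X) * cheb_num (Suc h) - fps_X^2 * cheb_num h"

lemma cheb_num_nth: "h \<le> n \<Longrightarrow> cheb_num h $ n = 0"
proof (induction h arbitrary: n rule: cheb_num.induct)
  case (3 h)
  have e: "cheb_num (Suc (Suc h)) = cheb_num (Suc h) - fps_X * cheb_num (Suc h) -
      fps_X * cheb_num (Suc h) - fps_X^2 * cheb_num h"
    by (simp add: algebra_simps)
  have "cheb_num (Suc h) $ n = 0" "cheb_num (Suc h) $ (n-1) = 0" "cheb_num h $ (n-2) = 0" "2 \<le> n"
    using 3 by simp_all
  then show ?case
    unfolding e fps_sub_nth fps_X_power_mult_nth fps_X_mult_nth by simp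
qed auto

text \<open>The equations at heights below \<open>m\<close> determine each series from the one at
  height 0. Each solves for the next series times \<open>fps_X\<close>, whence the factor
  \<open>fps_X ^ h\<close>.\<close>

lemma word_gf_valid_eq_cheb:
  assumes "0 < m" "h \<le> m"
  shows "fps_X ^ h * word_gf (valid (int m) (int h)) =
    cheb (2 * h) * word_gf (valid (int m) 0) - cheb_num h"
  using assms(2)
proof (induction h rule: cheb_num.induct)
  case 2
  let ?g = "word_gf (valid (int m) 0)" and ?g1 = "word_gf (valid (int m) 1)"
  have "?g - fps_X * ?g - 1 = fps_X * ?g1"
    by (subst word_gf_valid_0) (use assms in \<open>simp_all add: algebra_simps\<close>)
  moreover have "cheb 2 = 1 - fps_X" using cheb_rec[of 0] by (simp add: eval_nat_numeral)
  ultimately show ?case by (simp add: left_diff_distrib)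
next
  case (3 h)
  define G where "G = (\<lambda>h. word_gf (valid (int m) (int h)))"
  have IH: "fps_X ^ Suc h * G (Suc h) = cheb (2 * h + 2) * G 0 - cheb_num (Suc h)"
    "fps_X ^ h * G h = cheb (2 * h) * G 0 - cheb_num h"
    using 3 by (simp_all add: G_def)
  have "G (Suc h) = fps_X * (2 * G (Suc h) + G (Suc (Suc h)) + G h)"
    using word_gf_valid_middle[of "int (Suc h)" "int m"] 3 by (simp add: G_def add.commute)
  then have "fps_X * G (Suc (Suc h)) = (1 - 2 * fps_X) * G (Suc h) - fps_X * G h"
    by (simp add: algebra_simps)
  then have "fps_X ^ Suc (Suc h) * G (Suc (Suc h)) =
      fps_X ^ Suc h * ((1 - 2 * fps_X) * G (Suc h) - fps_X * G h)"
    by (simp add: mult.assoc mult.left_commute)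
  also have "\<dots> = (1 - 2 * fps_X) * (fps_X ^ Suc h * G (Suc h)) - fps_X^2 * (fps_X ^ h * G h)"
    by (simp add: algebra_simps power2_eq_square)
  also have "\<dots> = cheb (2 * h + 4) * G 0 - cheb_num (Suc (Suc h))"
    unfolding IH cheb_even_rec by (simp add: algebra_simps)
  also have "2 * h + 4 = 2 * Suc (Suc h)" by simp
  finally show ?case by (simp only: G_def of_nat_0)
qed simp

theorem theorem1p3:
  fixes k n :: nat
  assumes "k \<ge> 3" and "n \<ge> 2 * k"
  shows "L k n (2*k-2) =
           L k (n-1) (2*k-2) + L k (n-3) (2*k-5) + L k (n-3) (2*k-4)
             + L k (n-4) (2*k-5) + L k (n-4) (2*k-4)"
proof -
  \<comment> \<open>The shift removes the subtractions: the top height \<open>k-1\<close> is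
    \<open>h+2\<close>, and the indices of the recurrence become \<open>2*h+4\<close>,
    \<open>2*h+1\<close> and \<open>2*h+2\<close>.\<close>
  obtain h where k: "k = h + 3" using assms(1) by (metis add.commute le_Suc_ex)
  define m where "m = h + 2"
  define X where "X = (fps_X :: int fps)"
  define F where "F = word_gf (valid (int m) 0)"
  have F: "F = Abs_fps (\<lambda>n. int (f k n))"
    using f_eq_card_valid[OF assms(1)] by (simp add: F_def word_gf_def k m_def)
  define G where "G = (\<lambda>h. word_gf (valid (int m) (int h)))"
  \<comment> \<open>The contribution of the inhomogeneous parts to the equation at the top height.
    Its degree is at most \<open>h+4\<close>, less than \<open>2 * k\<close>.\<close>
  define Q where "Q = (1 - X) * cheb_num (h+2) -
      X^3 * (1 + X) * (2 * cheb_num (h+1) + X * cheb_num h)"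
  have G: "X ^ j * G j = cheb (2 * j) * F - cheb_num j" if "j \<le> m" for j
    using word_gf_valid_eq_cheb[of m j] that by (simp add: G_def F_def X_def m_def)
  have top: "(1 - X) * G m = X^2 * (1 + X) * (2 * G (h+1) + G h)"
    using word_gf_valid_top[of "int m"] by (simp add: G_def X_def m_def algebra_simps)
  \<comment> \<open>The top equation is multiplied by \<open>X ^ m\<close>, so that each series
    carries the power of \<open>X\<close> required by claim \<open>G\<close>.\<close>
  have "(1 - X) * (X ^ m * G m) = X ^ m * ((1 - X) * G m)"
    by (simp add: mult.left_commute)
  also have "\<dots> = X^3 * (1 + X) * (2 * (X ^ (h+1) * G (h+1)) + X * (X ^ h * G h))"
    unfolding top by (simp add: m_def algebra_simps eval_nat_numeral)
  finally have "(1 - X) * (cheb (2*m) * F - cheb_num m) =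
      X^3 * (1 + X) * (2 * (cheb (2*(h+1)) * F - cheb_num (h+1)) + X * (cheb (2*h) * F - cheb_num h))"
    using G[of m] G[of "h+1"] G[of h] by (simp add: m_def)
  \<comment> \<open>This turns \<open>2 * cheb (2*h+2) + X * cheb (2*h)\<close> into
    \<open>cheb (2*h+1) + cheb (2*h+2)\<close>, the two indices of the recurrence.\<close>
  moreover have "X * cheb (2*h) = cheb (2*h+1) - cheb (2*h+2)"
    using cheb_rec[of "2*h"] by (simp add: X_def)
  then have "X * (cheb (2*h) * F) = cheb (2*h+1) * F - cheb (2*h+2) * F"
    by (simp add: mult.assoc[symmetric] left_diff_distrib)
  moreover have "2 * m = 2*h+4" "2 * (h+1) = 2*h+2" "m = h+2" by (simp_all add: m_def)
  moreover have "C4 - X * C4 - X^3 * C1 - X^3 * C2 - X^4 * C1 - X^4 * C2 =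
      (1 - X) * N2 - X^3 * (1 + X) * (2 * N1 + X * N0)"
    if "(1 - X) * (C4 - N2) = X^3 * (1 + X) * (2 * (C2 - N1) + X * (C0 - N0))" "X * C0 = C1 - C2"
    for C0 C1 C2 C4 N0 N1 N2
    using that by algebra
  ultimately have "cheb (2*h+4) * F - X * (cheb (2*h+4) * F) - X^3 * (cheb (2*h+1) * F)
      - X^3 * (cheb (2*h+2) * F) - X^4 * (cheb (2*h+1) * F) - X^4 * (cheb (2*h+2) * F) = Q"
    unfolding Q_def by metis
  then have "(cheb (2*h+4) * F - X * (cheb (2*h+4) * F) - X^3 * (cheb (2*h+1) * F)
      - X^3 * (cheb (2*h+2) * F) - X^4 * (cheb (2*h+1) * F) - X^4 * (cheb (2*h+2) * F)) $ n = Q $ n"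
    by simp
  moreover have "Q $ n = 0"
  proof -
    have Q: "Q = cheb_num (h+2) - X * cheb_num (h+2) - X^3 * cheb_num (h+1) - X^3 * cheb_num (h+1)
        - X^4 * cheb_num (h+1) - X^4 * cheb_num (h+1) - X^4 * cheb_num h - X^5 * cheb_num h"
      by (simp add: Q_def algebra_simps eval_nat_numeral)
    show ?thesis
      unfolding Q X_def fps_sub_nth fps_X_power_mult_nth fps_X_mult_nth
      using assms(2) by (simp add: cheb_num_nth k del: cheb_num.simps)
  qed
  ultimately have "(cheb (2*h+4) * F) $ n = (cheb (2*h+4) * F) $ (n-1) + (cheb (2*h+1) * F) $ (n-3)
      + (cheb (2*h+2) * F) $ (n-3) + (cheb (2*h+1) * F) $ (n-4) + (cheb (2*h+2) * F) $ (n-4)"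
    unfolding X_def fps_sub_nth fps_X_power_mult_nth fps_X_mult_nth
    using assms(2) by (simp add: k)
  moreover have "2*k-2 = 2*h+4" "2*k-5 = 2*h+1" "2*k-4 = 2*h+2" by (simp_all add: k)
  \<comment> \<open>The last of these bounds is exactly \<open>n \<ge> 2 * k\<close>.\<close>
  moreover have "2*h+4 \<le> n" "2*h+4 \<le> n-1" "2*h+1 \<le> n-3" "2*h+2 \<le> n-3" "2*h+1 \<le> n-4" "2*h+2 \<le> n-4"
    using assms(2) by (simp_all add: k)
  ultimately show ?thesis by (simp only: L_eq_cheb F)
qed

end
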